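(* Consider a two-stripe symmetric circulant TSP instance with parameters $n, a_1, a_2$ satisfying the standing assumptions below, and let $g_1=\gcd(n,a_1)$, $r = \frac{n}{g_1}$ and $c = g_1$. Suppose the cylindrical coordinates of the vertex $-a_2 \bmod n$ are $(x, c-1)$. Let $m^*$ be the smallest integer $m$ such that $m \geq -\frac{c}{2}$ and $x \in \{2m+c \bmod r,\ -(2m+c) \bmod r\}$. Then: (i) if $m^* \leq 0$, the cost of an optimal (minimum-cost Hamiltonian) tour is $c$; (ii) if $0 < 2m^* < c-2$, the cost of an optimal tour is $c+2m^*$; (iii) if $2m^* \geq c-2$ or $m^*$ does not exist, the cost of an optimal tour is $2c-2$.
   Context: Two-stripe symmetric circulant TSP: the vertex set is $\mathbb{Z}_n=\{0,1,\dots,n-1\}$, and for two distinct integers $a_1,a_2\in\{1,\dots,\lfloor n/2\rfloor\}$ the only finite-cost edges are the edges $\{v, v\pm a_1 \bmod n\}$ (cost $0$) and $\{v, v\pm a_2 \bmod n\}$ (cost $1$); i.e., one seeks a Hamiltonian cycle in the circulant graph with these edges minimizing the number of edges of length $a_2$ used, and the cost of a tour is that number. Standing assumptions: with $g_1=\gcd(n,a_1)$ and $g_2=\gcd(n,a_1,a_2)$, we have $g_1>1$ and $g_2=1$. Cylindrical coordinates: with $r=n/g_1$ and $c=g_1$, every vertex $v\in\mathbb{Z}_n$ can be written uniquely as $v\equiv x a_1 + y a_2 \pmod n$ with $0\le x\le r-1$, $0\le y\le c-1$, and $(x,y)$ are its cylindrical coordinates (row $x$, column $y$). *)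

theory Defs
  imports Complex_Main "HOL-Number_Theory.Cong"
begin

definition two_stripe_instance :: "int \<Rightarrow> int \<Rightarrow> int \<Rightarrow> bool" where
  "two_stripe_instance n a1 a2 \<longleftrightarrow>
     a1 \<in> {1..n div 2} \<and> a2 \<in> {1..n div 2} \<and> a1 \<noteq> a2 \<and>
     gcd n a1 > 1 \<and> gcd (gcd n a1) a2 = 1"

definition stripe_edges :: "int \<Rightarrow> int \<Rightarrow> int set set" where
  "stripe_edges n a =
     {{v, w} |v w. v \<in> {0..<n} \<and> w \<in> {(v + a) mod n, (v - a) mod n}}"

text \<open>A Hamiltonian cycle is given by the list of its vertices in order of traversal; the
  last vertex is followed by the first one.\<close>

definition cycle_edges :: "'a list \<Rightarrow> 'a set set" where
  "cycle_edges t = {{t ! i, t ! (Suc i mod length t)} |i. i < length t}"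

definition hamiltonian_cycle :: "'a set \<Rightarrow> 'a set set \<Rightarrow> 'a list \<Rightarrow> bool" where
  "hamiltonian_cycle V E t \<longleftrightarrow>
     3 \<le> length t \<and> distinct t \<and> set t = V \<and> cycle_edges t \<subseteq> E"

definition tour :: "int \<Rightarrow> int \<Rightarrow> int \<Rightarrow> int list \<Rightarrow> bool" where
  "tour n a1 a2 t \<longleftrightarrow>
     hamiltonian_cycle {0..<n} (stripe_edges n a1 \<union> stripe_edges n a2) t"

definition tour_cost :: "int \<Rightarrow> int \<Rightarrow> int list \<Rightarrow> int" where
  "tour_cost n a2 t = int (card (cycle_edges t \<inter> stripe_edges n a2))"

text \<open>The value \<open>k\<close> is required to be attained, so this includes the existence of a tour.\<close>

definition optimal_tour_cost :: "int \<Rightarrow> int \<Rightarrow> int \<Rightarrow> int \<Rightarrow> bool" where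
  "optimal_tour_cost n a1 a2 k \<longleftrightarrow>
     (\<exists>t. tour n a1 a2 t \<and> tour_cost n a2 t = k) \<and>
     (\<forall>t. tour n a1 a2 t \<longrightarrow> k \<le> tour_cost n a2 t)"

definition cylindrical_coords :: "int \<Rightarrow> int \<Rightarrow> int \<Rightarrow> int \<Rightarrow> int \<times> int \<Rightarrow> bool" where
  "cylindrical_coords n a1 a2 v = (\<lambda>(x, y).
     x \<in> {0..n div gcd n a1 - 1} \<and> y \<in> {0..gcd n a1 - 1} \<and>
     [v = x * a1 + y * a2] (mod n))"

definition mstar_candidate :: "int \<Rightarrow> int \<Rightarrow> int \<Rightarrow> int \<Rightarrow> bool" where
  "mstar_candidate r c x m \<longleftrightarrow>
     real_of_int m \<ge> - real_of_int c / 2 \<and>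
     x \<in> {(2 * m + c) mod r, (- (2 * m + c)) mod r}"

text \<open>A predicate rather than a function, since there may be no candidate at all.\<close>

definition is_mstar :: "int \<Rightarrow> int \<Rightarrow> int \<Rightarrow> int \<Rightarrow> bool" where
  "is_mstar r c x m \<longleftrightarrow>
     mstar_candidate r c x m \<and> (\<forall>k. mstar_candidate r c x k \<longrightarrow> m \<le> k)"

end

theory Submission imports Defs begin

text \<open>In cylindrical coordinates the graph consists of \<open>c\<close> cycles (columns) of length \<open>r\<close>, consecutive
  columns being joined row by row, except that the step from column \<open>c - 1\<close> back to column \<open>0\<close>
  shifts the rows by \<open>-x\<close>.

  Lower bound. In a tour of cost \<open>N < 2c - 2\<close> some gap between neighbouring columns is crossed exactly
  once: otherwise two gaps are not crossed at all and the tour is disconnected, or at least \<open>c - 1\<close>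
  gaps are crossed twice. Cutting there yields a Hamiltonian path of the \<open>r \<times> c\<close> cylinder
  from \<open>(0, 0)\<close> to \<open>(x, c - 1)\<close> with \<open>N - 1\<close> horizontal steps. A row without horizontal steps is
  traversed vertically in all \<open>c\<close> columns. There cannot be such rows both above and below the
  segment from \<open>0\<close> to \<open>x\<close>, since the path would then cross the two rows \<open>2c\<close> times altogether, an even
  number, although they separate its endpoints. So on one of the two sides every row carries a horizontal step, and
  \<open>x\<close> is congruent to some \<open>j\<close> with \<open>\<bar>j\<bar> \<le> N\<close>; a bipartiteness count gives \<open>j \<equiv> c (mod 2)\<close>.

  Upper bound. Traversing a single column and moving on shifts the row by \<open>\<plusminus>1\<close> at cost \<open>1\<close>; two
  columns can be traversed by a zigzag that shifts the row by \<open>\<plusminus>4\<close> at cost \<open>4\<close>. A snake through the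
  rows \<open>1, \<dots>, r - 1\<close> that returns along row \<open>0\<close> costs \<open>2c - 2\<close>.\<close>

section \<open>Hamiltonian paths in a cylinder\<close>

text \<open>Each parity argument below labels the vertices by integers and compares the labels at
  the two ends of the path with the number of steps that change the label by an odd amount.\<close>

lemma parity_walk:
  fixes g :: "nat \<Rightarrow> int"
  shows "even (g m - g 0 - int (card {i. i < m \<and> odd (g (Suc i) - g i)}))"
proof (induction m)
  case (Suc m)
  have "{i. i < Suc m \<and> odd (g (Suc i) - g i)} =
    (if odd (g (Suc m) - g m) then insert m {i. i < m \<and> odd (g (Suc i) - g i)}
     else {i. i < m \<and> odd (g (Suc i) - g i)})"
    by (auto simp: less_Suc_eq)
  moreover have "finite {i. i < m \<and> odd (g (Suc i) - g i)}" by simp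
  ultimately have "int (card {i. i < Suc m \<and> odd (g (Suc i) - g i)}) =
    int (card {i. i < m \<and> odd (g (Suc i) - g i)}) + (if odd (g (Suc m) - g m) then 1 else 0)"
    by (simp del: even_diff)
  then show ?case using Suc by presburger
qed simp

lemma odd_abs_one: "\<bar>z\<bar> = 1 \<Longrightarrow> odd z" for z :: int
  by (cases "z \<ge> 0") (auto dest: sym[of _ 1])

text \<open>\<open>X i\<close> and \<open>Y i\<close> are row and column of the \<open>i\<close>-th
  vertex. Rows are cyclic: a difference of \<open>r - 1\<close> is the step between rows
  \<open>0\<close> and \<open>r - 1\<close>. Columns are not, since the tour has been cut at its
  only passage between columns \<open>c - 1\<close> and \<open>0\<close>.\<close>

locale cylinder_path =
  fixes r c x :: int and X Y :: "nat \<Rightarrow> int" and n :: nat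
  assumes r2: "r \<ge> 2" and c2: "c \<ge> 2" and n_eq: "int n = r * c"
    and bij: "bij_betw (\<lambda>i. (X i, Y i)) {..<n} ({0..<r} \<times> {0..<c})"
    and X_first: "X 0 = 0" and Y_first: "Y 0 = 0"
    and X_last: "X (n - 1) = x" and Y_last: "Y (n - 1) = c - 1"
    and step: "\<And>i. Suc i < n \<Longrightarrow>
      Y (Suc i) = Y i \<and> (\<bar>X (Suc i) - X i\<bar> = 1 \<or> \<bar>X (Suc i) - X i\<bar> = r - 1) \<or>
      X (Suc i) = X i \<and> \<bar>Y (Suc i) - Y i\<bar> = 1"
begin

definition horiz :: "nat set" where
  "horiz = {i. Suc i < n \<and> Y (Suc i) \<noteq> Y i}"

text \<open>The endpoint rows \<open>0\<close> and \<open>x\<close> are excluded so that every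
  vertex of the row is interior to the path. A horizontal step stays in its row, so testing its
  start suffices.\<close>

definition unused :: "int \<Rightarrow> bool" where
  "unused \<rho> \<longleftrightarrow> 0 < \<rho> \<and> \<rho> < r \<and> \<rho> \<noteq> x \<and> (\<forall>i\<in>horiz. X i \<noteq> \<rho>)"

definition up :: "int \<Rightarrow> int" where
  "up \<rho> = (if \<rho> = r - 1 then 0 else \<rho> + 1)"

definition cut :: "int \<Rightarrow> nat set" where
  "cut \<rho> = {i. Suc i < n \<and> Y (Suc i) = Y i \<and> {X i, X (Suc i)} = {\<rho>, up \<rho>}}"

lemma n_pos: "n \<ge> 4"
proof -
  have "2 * 2 \<le> r * c" using r2 c2 by (intro mult_mono) auto
  then show ?thesis using n_eq by linarith
qed

lemma range: "i < n \<Longrightarrow> 0 \<le> X i \<and> X i < r \<and> 0 \<le> Y i \<and> Y i < c"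
  using bij unfolding bij_betw_def by fastforce

lemma inj: "i < n \<Longrightarrow> j < n \<Longrightarrow> X i = X j \<Longrightarrow> Y i = Y j \<Longrightarrow> i = j"
  using bij unfolding bij_betw_def inj_on_def by auto

lemma x_range: "0 \<le> x" "x < r"
  using range[of "n - 1"] X_last n_pos by auto

lemma finite_horiz [simp]: "finite horiz"
  unfolding horiz_def by (rule finite_subset[of _ "{..<n}"]) auto

lemma finite_cut [simp]: "finite (cut \<rho>)"
  unfolding cut_def by (rule finite_subset[of _ "{..<n}"]) auto

text \<open>Without horizontal steps the path enters and leaves the vertex through its two distinct
  neighbours in the column, so exactly one of the two steps joins it to row
  \<open>up \<rho>\<close>.\<close>

lemma unused_vertex:
  assumes u: "unused \<rho>" and y: "0 \<le> y" "y < c"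
  obtains k where "Suc (Suc k) < n" "Y k = y" "Y (Suc k) = y" "Y (Suc (Suc k)) = y"
    "X (Suc k) = \<rho>" "k \<in> cut \<rho> \<and> Suc k \<notin> cut \<rho> \<or> k \<notin> cut \<rho> \<and> Suc k \<in> cut \<rho>"
proof -
  have "(\<rho>, y) \<in> {0..<r} \<times> {0..<c}" using u y unfolding unused_def by auto
  then have "(\<rho>, y) \<in> (\<lambda>i. (X i, Y i)) ` {..<n}" using bij unfolding bij_betw_def by simp
  then obtain i where i: "i < n" "X i = \<rho>" "Y i = y" by auto
  have i0: "i \<noteq> 0" using i(2) X_first u unfolding unused_def by (cases "i = 0") auto
  then obtain k where k: "i = Suc k" by (cases i) auto
  have "i \<noteq> n - 1" using i(2) X_last u unfolding unused_def by (cases "i = n - 1") auto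
  then have kn: "Suc (Suc k) < n" using i k by linarith
  have nh: "Y (Suc (Suc k)) = Y (Suc k)" using u i k kn unfolding unused_def horiz_def by auto
  have nh': "Y (Suc k) = Y k"
  proof (rule ccontr)
    assume "Y (Suc k) \<noteq> Y k"
    moreover from this have "X (Suc k) = X k" using step[of k] kn by auto
    ultimately show False using u i k kn unfolding unused_def horiz_def by auto
  qed
  have ne: "X k \<noteq> X (Suc (Suc k))" using inj[of k "Suc (Suc k)"] nh nh' kn by auto
  have s1: "\<bar>X (Suc k) - X k\<bar> = 1 \<or> \<bar>X (Suc k) - X k\<bar> = r - 1"
    and s2: "\<bar>X (Suc (Suc k)) - X (Suc k)\<bar> = 1 \<or> \<bar>X (Suc (Suc k)) - X (Suc k)\<bar> = r - 1"
    using step[of k] step[of "Suc k"] nh nh' kn by auto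
  have rg: "0 \<le> X k" "X k < r" "0 \<le> X (Suc (Suc k))" "X (Suc (Suc k)) < r" "0 < \<rho>" "\<rho> < r"
    using range kn u unfolding unused_def by auto
  \<comment> \<open>For \<open>r = 2\<close> both neighbours would lie in row \<open>0\<close>,
    which \<open>ne\<close> excludes.\<close>
  have "(X k = up \<rho> \<and> X (Suc (Suc k)) = \<rho> - 1 \<or> X k = \<rho> - 1 \<and> X (Suc (Suc k)) = up \<rho>) \<and> up \<rho> \<noteq> \<rho> - 1"
    using s1 s2 ne rg i k unfolding up_def by (auto simp: abs_if split: if_splits)
  then have "k \<in> cut \<rho> \<and> Suc k \<notin> cut \<rho> \<or> k \<notin> cut \<rho> \<and> Suc k \<in> cut \<rho>"
    using nh nh' kn i k unfolding cut_def by (auto simp: doubleton_eq_iff)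
  moreover have "Y (Suc k) = y" "X (Suc k) = \<rho>" using i k by simp_all
  ultimately show ?thesis using that[of k] kn nh nh' by metis
qed

text \<open>Sending a step to its column is a bijection, because each column has exactly one cut
  step at its vertex in row \<open>\<rho>\<close>.\<close>

lemma card_cut:
  assumes u: "unused \<rho>"
  shows "int (card (cut \<rho>)) = c"
proof -
  have "bij_betw Y (cut \<rho>) {0..<c}"
    unfolding bij_betw_def
  proof (intro conjI inj_onI equalityI subsetI)
    fix i j assume i: "i \<in> cut \<rho>" and j: "j \<in> cut \<rho>" and e: "Y i = Y j"
    have "0 \<le> Y i" "Y i < c" using i range[of i] unfolding cut_def by auto
    from unused_vertex[OF u this] obtain k where k: "Suc (Suc k) < n" "Y (Suc k) = Y i"
      "X (Suc k) = \<rho>" "k \<in> cut \<rho> \<and> Suc k \<notin> cut \<rho> \<or> k \<notin> cut \<rho> \<and> Suc k \<in> cut \<rho>" by metis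
    \<comment> \<open>A cut step in this column touches the vertex \<open>(\<rho>, Y i)\<close>,
      hence is one of the two steps there.\<close>
    have key: "l = k \<or> l = Suc k" if l: "l \<in> cut \<rho>" "Y l = Y i" for l
    proof -
      have "X l = \<rho> \<or> X (Suc l) = \<rho>" "Suc l < n" "Y (Suc l) = Y l"
        using l unfolding cut_def by (auto simp: doubleton_eq_iff)
      then show ?thesis using inj[of l "Suc k"] inj[of "Suc l" "Suc k"] k l by auto
    qed
    show "i = j" using key[OF i refl] key[OF j e[symmetric]] k(4) i j by auto
  next
    fix y assume "y \<in> Y ` cut \<rho>"
    then show "y \<in> {0..<c}" using range unfolding cut_def by auto
  next
    fix y assume y: "y \<in> {0..<c}"
    from unused_vertex[OF u, of y] y obtain k where "Y k = y" "Y (Suc k) = y"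
      "k \<in> cut \<rho> \<and> Suc k \<notin> cut \<rho> \<or> k \<notin> cut \<rho> \<and> Suc k \<in> cut \<rho>" by (metis atLeastLessThan_iff)
    then show "y \<in> Y ` cut \<rho>" by (metis imageI)
  qed
  then have "card (cut \<rho>) = card {0..<c}" by (rule bij_betw_same_card)
  then show ?thesis using c2 by simp
qed

section \<open>Parity and counting constraints on the final row\<close>

lemma x_parity_even:
  assumes "even r"
  shows "even (x - c)"
proof -
  \<comment> \<open>For even \<open>r\<close> this sum 2-colours the cylinder, since the wrap-around
    changes the row by the odd number \<open>r - 1\<close>; the number \<open>r * c - 1\<close> of
    steps is odd.\<close>
  let ?g = "\<lambda>i. X i + Y i"
  have "odd (?g (Suc i) - ?g i)" if "i < n - 1" for i
  proof -
    have "odd (r - 1)" using assms by simp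
    have "odd z" if "\<bar>z\<bar> = r - 1" for z
      using that \<open>odd (r - 1)\<close> by (metis dvd_abs_iff)
    then have "odd (X (Suc i) - X i) \<and> Y (Suc i) = Y i \<or> X (Suc i) = X i \<and> odd (Y (Suc i) - Y i)"
      using step[of i] odd_abs_one that by (metis less_diff_conv Suc_eq_plus1)
    then show ?thesis by auto
  qed
  then have "{i. i < n - 1 \<and> odd (?g (Suc i) - ?g i)} = {..<n - 1}" by auto
  then have "even (?g (n - 1) - ?g 0 - int (n - 1))"
    using parity_walk[of ?g "n - 1"] by (metis card_lessThan)
  moreover have "?g (n - 1) = x + (c - 1)" "?g 0 = 0" "int (n - 1) = int n - 1"
    using X_first Y_first X_last Y_last n_pos by (simp_all add: of_nat_diff)
  ultimately have "even (x + (c - 1) - 0 - (int n - 1))" by metis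
  moreover have "even (int n)" using assms n_eq by simp
  ultimately show ?thesis by presburger
qed

text \<open>Cutting the cylinder open along the unused row turns it into a bipartite grid.\<close>

lemma x_parity_unused:
  assumes u: "unused \<rho>" and "odd r"
  shows "even ((if x \<le> \<rho> then x else x - r) - c)"
proof -
  \<comment> \<open>The labels run consecutively from \<open>\<rho> + 1 - r\<close> to
    \<open>\<rho>\<close>. The step between rows \<open>r - 1\<close> and \<open>0\<close> becomes
    ordinary unless it is in the cut, and only cut steps change the label by the even amount
    \<open>r - 1\<close>.\<close>
  let ?f = "\<lambda>z. if z \<le> \<rho> then z else z - r"
  let ?g = "\<lambda>i. ?f (X i) + Y i"
  have u': "0 < \<rho>" "\<rho> < r" using u unfolding unused_def by auto
  have iff: "odd (?g (Suc i) - ?g i) \<longleftrightarrow> i \<notin> cut \<rho>" if i: "i < n - 1" for i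
  proof -
    have rg: "0 \<le> X i" "X i < r" "0 \<le> X (Suc i)" "X (Suc i) < r"
      using range[of i] range[of "Suc i"] i by auto
    show ?thesis
    proof (cases "Y (Suc i) = Y i")
      case True
      then have cut_iff: "i \<in> cut \<rho> \<longleftrightarrow> X i = \<rho> \<and> X (Suc i) = up \<rho> \<or> X i = up \<rho> \<and> X (Suc i) = \<rho>"
        using i unfolding cut_def by (auto simp: doubleton_eq_iff)
      have "\<bar>X (Suc i) - X i\<bar> = 1 \<or> \<bar>X (Suc i) - X i\<bar> = r - 1" using step[of i] i True by auto
      then consider "X (Suc i) = X i + 1" | "X (Suc i) = X i - 1"
        | "X (Suc i) = 0" "X i = r - 1" | "X i = 0" "X (Suc i) = r - 1"
        using rg by (auto simp: abs_if split: if_splits)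
      then show ?thesis unfolding cut_iff up_def
        using True rg u' \<open>odd r\<close> by cases auto
    next
      case False
      then have "X (Suc i) = X i" "\<bar>Y (Suc i) - Y i\<bar> = 1" using step[of i] i by auto
      moreover from this have "odd (Y (Suc i) - Y i)" using odd_abs_one by blast
      ultimately show ?thesis using False unfolding cut_def by auto
    qed
  qed
  have "{i. i < n - 1 \<and> odd (?g (Suc i) - ?g i)} = {..<n - 1} - cut \<rho>"
    using iff unfolding lessThan_def by blast
  moreover have "cut \<rho> \<subseteq> {..<n - 1}" unfolding cut_def by auto
  moreover from this have "int (card ({..<n - 1} - cut \<rho>)) = r * c - 1 - c"
    using card_cut[OF u] n_eq n_pos card_mono[of "{..<n - 1}" "cut \<rho>"]
    by (simp add: card_Diff_subset of_nat_diff)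
  ultimately have cd: "int (card {i. i < n - 1 \<and> odd (?g (Suc i) - ?g i)}) = r * c - 1 - c"
    by argo
  have "even (?g (n - 1) - ?g 0 - (r * c - 1 - c))"
    using parity_walk[of ?g "n - 1"] unfolding cd .
  moreover have "?g (n - 1) = ?f x + (c - 1)" "?g 0 = 0"
    using X_first Y_first X_last Y_last u' by simp_all
  ultimately have "even (?f x + (c - 1) - (r * c - 1 - c))" by (metis diff_zero)
  moreover have "even (r * c - c)" using \<open>odd r\<close> by simp
  moreover have "even (z - c)" if "even (z + (c - 1) - (w - 1 - c))" "even (w - c)" for z w :: int
    using that by presburger
  ultimately show ?thesis by blast
qed

lemma not_unused_both_sides:
  assumes u: "unused \<rho>" "unused \<sigma>" and "\<rho> < x" "x < \<sigma>"
  shows False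
proof -
  \<comment> \<open>Indicator of the band between the two cuts. \<open>cut \<rho>\<close> lies just
    beyond row \<open>\<rho>\<close>, so \<open>\<rho>\<close> is outside and
    \<open>\<sigma>\<close> inside. The path starts outside and ends inside, yet crosses the border
    \<open>2 * c\<close> times.\<close>
  let ?g = "\<lambda>i. if \<rho> < X i \<and> X i \<le> \<sigma> then 1 else 0 :: int"
  have u': "0 < \<rho>" "\<sigma> < r" using u unfolding unused_def by auto
  have iff: "odd (?g (Suc i) - ?g i) \<longleftrightarrow> i \<in> cut \<rho> \<union> cut \<sigma>" if i: "i < n - 1" for i
  proof -
    have rg: "0 \<le> X i" "X i < r" "0 \<le> X (Suc i)" "X (Suc i) < r"
      using range[of i] range[of "Suc i"] i by auto
    show ?thesis
    proof (cases "Y (Suc i) = Y i")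
      case True
      then have cut_iff: "i \<in> cut \<tau> \<longleftrightarrow> X i = \<tau> \<and> X (Suc i) = up \<tau> \<or> X i = up \<tau> \<and> X (Suc i) = \<tau>" for \<tau>
        using i unfolding cut_def by (auto simp: doubleton_eq_iff)
      have "\<bar>X (Suc i) - X i\<bar> = 1 \<or> \<bar>X (Suc i) - X i\<bar> = r - 1" using step[of i] i True by auto
      then consider "X (Suc i) = X i + 1" | "X (Suc i) = X i - 1"
        | "X (Suc i) = 0" "X i = r - 1" | "X i = 0" "X (Suc i) = r - 1"
        using rg by (auto simp: abs_if split: if_splits)
      then show ?thesis unfolding Un_iff cut_iff up_def
        using True rg u' assms(3,4) by cases auto
    next
      case False
      then show ?thesis using step[of i] i unfolding cut_def by auto
    qed
  qed
  have "{\<rho>, up \<rho>} \<noteq> {\<sigma>, up \<sigma>}"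
    using assms u' unfolding up_def by (auto simp: doubleton_eq_iff)
  then have "cut \<rho> \<inter> cut \<sigma> = {}" unfolding cut_def by auto
  moreover have cut_sub: "cut \<tau> \<subseteq> {i. i < n - 1}" for \<tau> unfolding cut_def by auto
  have "{i. i < n - 1 \<and> odd (?g (Suc i) - ?g i)} = cut \<rho> \<union> cut \<sigma>"
    using iff cut_sub by blast
  moreover have "card (cut \<rho> \<union> cut \<sigma>) = card (cut \<rho>) + card (cut \<sigma>)"
    using \<open>cut \<rho> \<inter> cut \<sigma> = {}\<close> by (simp add: card_Un_disjoint)
  ultimately have cd: "int (card {i. i < n - 1 \<and> odd (?g (Suc i) - ?g i)}) = 2 * c"
    using card_cut[OF u(1)] card_cut[OF u(2)] by presburger
  have "even (?g (n - 1) - ?g 0 - 2 * c)"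
    using parity_walk[of ?g "n - 1"] unfolding cd .
  then show False using X_first X_last u' assms by simp
qed

text \<open>Pigeonhole: the open interval has \<open>b - a - 1\<close> rows, more than there are
  horizontal steps.\<close>

lemma exists_unused:
  assumes "0 \<le> a" "b \<le> r" "x \<notin> {a<..<b}" "int (card horiz) < b - a - 1"
  obtains \<rho> where "unused \<rho>" "a < \<rho>" "\<rho> < b"
proof -
  have "card (X ` horiz) < card {a<..<b}"
    using card_image_le[of horiz X] assms by simp
  then have "\<not> {a<..<b} \<subseteq> X ` horiz"
    using card_mono[of "X ` horiz" "{a<..<b}"] by auto
  then obtain \<rho> where \<rho>: "\<rho> \<in> {a<..<b}" "\<rho> \<notin> X ` horiz" by blast
  then have "\<rho> \<noteq> x" using assms(3) by blast
  then have "unused \<rho>" using \<rho> assms(1,2) unfolding unused_def by (auto dest: imageI)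
  then show ?thesis using that \<rho>(1) by simp
qed

text \<open>The column rises from \<open>0\<close> to \<open>c - 1\<close>, by at most one per
  horizontal step.\<close>

lemma card_horiz_ge: "c \<le> int (card horiz) + 1"
proof -
  have "Y m \<le> int (card {i\<in>horiz. i < m})" if "m < n" for m
    using that
  proof (induction m)
    case 0
    then show ?case using Y_first by simp
  next
    case (Suc m)
    show ?case
    proof (cases "m \<in> horiz")
      case True
      then have "{i\<in>horiz. i < Suc m} = insert m {i\<in>horiz. i < m}" by (auto simp: less_Suc_eq)
      then have "card {i\<in>horiz. i < Suc m} = Suc (card {i\<in>horiz. i < m})" by simp
      moreover have "Y (Suc m) \<le> Y m + 1" using step[OF Suc.prems] by auto
      ultimately show ?thesis using Suc by simp
    next
      case False
      then have "{i\<in>horiz. i < Suc m} = {i\<in>horiz. i < m}" by (auto simp: less_Suc_eq)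
      moreover have "Y (Suc m) = Y m" using False Suc.prems unfolding horiz_def by simp
      ultimately show ?thesis using Suc by simp
    qed
  qed
  from this[of "n - 1"] have "c - 1 \<le> int (card {i\<in>horiz. i < n - 1})"
    using n_pos Y_last by simp
  moreover have "card {i\<in>horiz. i < n - 1} \<le> card horiz" by (rule card_mono) auto
  ultimately show ?thesis by linarith
qed

lemma shift_bound:
  obtains j where "r dvd j - x" "\<bar>j\<bar> \<le> int (card horiz) + 1" "even (j - c)"
proof -
  let ?M = "int (card horiz)"
  have lo: "\<exists>\<rho>. unused \<rho> \<and> \<rho> < x" if "x > ?M + 1"
    by (rule exists_unused[of 0 x]) (use that x_range in auto)
  have hi: "\<exists>\<rho>. unused \<rho> \<and> x < \<rho>" if "r - x > ?M + 1"
    by (rule exists_unused[of x r]) (use that x_range in auto)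
  have "(x \<le> ?M + 1 \<and> even (x - c)) \<or> (r - x \<le> ?M + 1 \<and> even (x - r - c))"
  proof (cases "even r")
    case True
    then have "even (x - c)" "even (x - r - c)" using x_parity_even by auto
    moreover have "x \<le> ?M + 1 \<or> r - x \<le> ?M + 1"
      using lo hi not_unused_both_sides by (meson not_le)
    ultimately show ?thesis by blast
  next
    case False
    show ?thesis
    proof (cases "even (x - c)")
      case True
      have "x \<le> ?M + 1"
      proof (rule ccontr)
        assume "\<not> x \<le> ?M + 1"
        then obtain \<rho> where "unused \<rho>" "\<rho> < x" using lo by auto
        then have "even (x - r - c)" using x_parity_unused[of \<rho>] False by auto
        then show False using True False by presburger
      qed
      then show ?thesis using True by simp
    next
      case ne: False
      have "r - x \<le> ?M + 1"
      proof (rule ccontr)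
        assume "\<not> r - x \<le> ?M + 1"
        then obtain \<rho> where "unused \<rho>" "x < \<rho>" using hi by auto
        then show False using x_parity_unused[of \<rho>] False ne by auto
      qed
      moreover have "even (x - r - c)" using ne False by presburger
      ultimately show ?thesis by simp
    qed
  qed
  then show ?thesis
  proof
    assume "x \<le> ?M + 1 \<and> even (x - c)"
    then show ?thesis using that[of x] x_range by simp
  next
    assume "r - x \<le> ?M + 1 \<and> even (x - r - c)"
    then show ?thesis using that[of "x - r"] x_range by simp
  qed
qed

end

section \<open>Coordinates\<close>

lemma dvd_iff_of_dvd_diff: "m dvd p - q \<Longrightarrow> m dvd p \<longleftrightarrow> m dvd q" for m p q :: int
  by (metis dvd_diff_left_iff dvd_diff_commute dvd_diff_right_iff)

text \<open>\<open>twist\<close> restates that \<open>- a2\<close> has coordinates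
  \<open>(x, c - 1)\<close>: going once through all columns shifts the row by
  \<open>- x\<close>.\<close>

locale stripes =
  fixes n a1 a2 r c x :: int
  assumes r2: "r \<ge> 2" and c2: "c \<ge> 2" and n_eq: "n = r * c"
    and gcd_n_a1: "gcd n a1 = c" and gcd_c_a2: "gcd c a2 = 1"
    and x_range: "0 \<le> x" "x < r" and twist: "n dvd c * a2 + x * a1"
begin

lemma n_ge4: "n \<ge> 4"
  using mult_mono[of 2 r 2 c] r2 c2 n_eq by auto

lemma c_dvd_a1: "c dvd a1"
  using gcd_n_a1 by (metis gcd_dvd2)

lemma c_dvd_if_n_dvd: "n dvd z \<Longrightarrow> c dvd z"
  unfolding n_eq by (metis dvd_mult_right)

text \<open>\<open>a1\<close> has order \<open>r\<close> modulo \<open>n\<close>, because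
  \<open>a1 div c\<close> is coprime to \<open>r\<close>.\<close>

lemma n_dvd_mult_a1_iff: "n dvd w * a1 \<longleftrightarrow> r dvd w"
proof -
  obtain a' where a': "a1 = c * a'" using c_dvd_a1 by blast
  have "c * gcd r a' = c"
    using gcd_n_a1 gcd_mult_distrib_int[of c r a'] c2 by (simp add: n_eq a' mult.commute)
  then have "coprime r a'" using c2 by (simp add: coprime_iff_gcd_eq_1)
  then have "r dvd w * a' \<longleftrightarrow> r dvd w" by (simp add: coprime_dvd_mult_left_iff)
  moreover have "n dvd w * a1 \<longleftrightarrow> r dvd w * a'"
    using c2 dvd_mult_cancel_right[of r c "w * a'"] by (simp add: n_eq a' ac_simps)
  ultimately show ?thesis by simp
qed

text \<open>The relations between \<open>a1\<close> and \<open>a2\<close> modulo \<open>n\<close>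
  form the lattice generated by \<open>(r, 0)\<close> and \<open>(x, c)\<close>: a relation forces
  \<open>c dvd v\<close>, and subtracting multiples of \<open>twist\<close> leaves a multiple of
  \<open>a1\<close> alone.\<close>

lemma kernel: "n dvd u * a1 + v * a2 \<longleftrightarrow> (\<exists>k. v = k * c \<and> r dvd u - k * x)"
proof
  assume d: "n dvd u * a1 + v * a2"
  then have "c dvd v * a2"
    using c_dvd_if_n_dvd c_dvd_a1 by (meson dvd_add_right_iff dvd_mult)
  then have "c dvd v" using gcd_c_a2 by (simp add: coprime_dvd_mult_left_iff coprime_iff_gcd_eq_1)
  then obtain k where k: "v = k * c" by (metis dvd_def mult.commute)
  have "(u - k * x) * a1 = u * a1 + v * a2 - k * (c * a2 + x * a1)"
    by (simp add: k algebra_simps)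
  then have "n dvd (u - k * x) * a1" using d twist by (metis dvd_diff dvd_mult)
  then show "\<exists>k. v = k * c \<and> r dvd u - k * x" using k n_dvd_mult_a1_iff by blast
next
  assume "\<exists>k. v = k * c \<and> r dvd u - k * x"
  then obtain k where k: "v = k * c" "n dvd (u - k * x) * a1" using n_dvd_mult_a1_iff by blast
  have "u * a1 + v * a2 = (u - k * x) * a1 + k * (c * a2 + x * a1)"
    by (simp add: k algebra_simps)
  then show "n dvd u * a1 + v * a2" using k twist by (metis dvd_add dvd_mult)
qed

lemma box_inj:
  assumes "u \<in> {0..<r}" "u' \<in> {0..<r}" "v \<in> {0..<c}" "v' \<in> {0..<c}"
    and d: "n dvd (u * a1 + v * a2) - (u' * a1 + v' * a2)"
  shows "u = u' \<and> v = v'"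
proof -
  have "n dvd (u - u') * a1 + (v - v') * a2" using d by (simp add: algebra_simps)
  then obtain k where k: "v - v' = k * c" "r dvd (u - u') - k * x" using kernel by blast
  then have "c dvd v - v'" by simp
  then have "v = v'" using assms(3,4) zdvd_imp_le[of c "v - v'"] zdvd_imp_le[of c "v' - v"]
    by (force simp: dvd_diff_commute)
  then have "k = 0" using k(1) c2 by simp
  then have "r dvd u - u'" using k by simp
  then have "u = u'" using assms(1,2) zdvd_imp_le[of r "u - u'"] zdvd_imp_le[of r "u' - u"]
    by (force simp: dvd_diff_commute)
  then show ?thesis using \<open>v = v'\<close> by simp
qed

text \<open>By counting: the box has \<open>r * c = n\<close> points, and \<open>box_inj\<close>
  makes their residues distinct.\<close>

lemma box_surj: "\<exists>u\<in>{0..<r}. \<exists>v\<in>{0..<c}. n dvd w - (u * a1 + v * a2)"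
proof -
  let ?f = "\<lambda>(u, v). (u * a1 + v * a2) mod n"
  let ?B = "{0..<r} \<times> {0..<c}"
  have inj: "inj_on ?f ?B"
    using box_inj by (fastforce simp: inj_on_def mod_eq_dvd_iff)
  have "card (?f ` ?B) = card {0..<n}"
    using card_image[OF inj] r2 c2 by (simp add: n_eq nat_mult_distrib)
  moreover have "?f ` ?B \<subseteq> {0..<n}" using n_ge4 by auto
  ultimately have "?f ` ?B = {0..<n}" by (simp add: card_subset_eq)
  then have "w mod n \<in> ?f ` ?B" using n_ge4 by simp
  then show ?thesis by (fastforce simp: mod_eq_dvd_iff)
qed

definition coord :: "int \<Rightarrow> int \<times> int" where
  "coord w = (SOME p. p \<in> {0..<r} \<times> {0..<c} \<and> n dvd w - (fst p * a1 + snd p * a2))"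

definition row :: "int \<Rightarrow> int" where "row w = fst (coord w)"
definition col :: "int \<Rightarrow> int" where "col w = snd (coord w)"

lemma coord: "row w \<in> {0..<r}" "col w \<in> {0..<c}" "n dvd w - (row w * a1 + col w * a2)"
proof -
  obtain u v where "(u, v) \<in> {0..<r} \<times> {0..<c} \<and> n dvd w - (fst (u, v) * a1 + snd (u, v) * a2)"
    using box_surj[of w] by auto
  from someI[of "\<lambda>p. p \<in> {0..<r} \<times> {0..<c} \<and> n dvd w - (fst p * a1 + snd p * a2)", OF this]
  show "row w \<in> {0..<r}" "col w \<in> {0..<c}" "n dvd w - (row w * a1 + col w * a2)"
    unfolding row_def col_def coord_def by (auto simp: mem_Times_iff)
qed

lemma coord_eqI:
  assumes "u \<in> {0..<r}" "v \<in> {0..<c}" "n dvd w - (u * a1 + v * a2)"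
  shows "row w = u" "col w = v"
proof -
  have "n dvd (w - (u * a1 + v * a2)) - (w - (row w * a1 + col w * a2))"
    using assms(3) coord(3) by (rule dvd_diff)
  then have "n dvd (row w * a1 + col w * a2) - (u * a1 + v * a2)" by (simp add: algebra_simps)
  then have "row w = u \<and> col w = v"
    using box_inj assms(1,2) coord(1,2) by blast
  then show "row w = u" "col w = v" by auto
qed

text \<open>Since \<open>c dvd a1\<close>, the residue modulo \<open>c\<close> ignores the row, and
  it determines the column because \<open>a2\<close> is invertible modulo \<open>c\<close>.\<close>

lemma col_iff:
  assumes "y \<in> {0..<c}"
  shows "c dvd w - y * a2 \<longleftrightarrow> col w = y"
proof -
  have "c dvd w - (row w * a1 + col w * a2)" using coord c_dvd_if_n_dvd by blast
  then have 1: "c dvd w - col w * a2"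
    using c_dvd_a1 by (metis add.commute diff_diff_add dvd_diff_right_iff dvd_mult dvd_diff_left_iff)
  have "c dvd w - y * a2 \<longleftrightarrow> c dvd (col w - y) * a2"
    using 1 by (intro dvd_iff_of_dvd_diff) (simp add: algebra_simps)
  also have "\<dots> \<longleftrightarrow> c dvd col w - y"
    using gcd_c_a2 by (simp add: coprime_dvd_mult_left_iff coprime_iff_gcd_eq_1)
  also have "\<dots> \<longleftrightarrow> col w = y"
    using assms coord(2)[of w] zdvd_imp_le[of c "col w - y"] zdvd_imp_le[of c "y - col w"]
    by (force simp: dvd_diff_commute)
  finally show ?thesis .
qed

lemma step_a1:
  assumes d: "n dvd w' - w - a1"
  shows "col w' = col w" "row w' = (if row w = r - 1 then 0 else row w + 1)"
proof -
  let ?u = "if row w = r - 1 then 0 else row w + 1"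
  have "n dvd (row w + 1 - ?u) * a1" by (auto simp: n_dvd_mult_a1_iff)
  then have "n dvd (w' - w - a1) + (w - (row w * a1 + col w * a2)) + (row w + 1 - ?u) * a1"
    using d coord by (intro dvd_add) auto
  then have "n dvd w' - (?u * a1 + col w * a2)" by (simp add: algebra_simps)
  then show "col w' = col w" "row w' = ?u"
    using coord_eqI[of ?u "col w" w'] coord[of w] r2 by (auto split: if_splits)
qed

text \<open>From column \<open>c - 1\<close> the step returns to column \<open>0\<close> with the
  row shifted by \<open>- x\<close>; there only the column is recorded.\<close>

lemma step_a2:
  assumes d: "n dvd w' - w - a2"
  shows "col w' = (if col w = c - 1 then 0 else col w + 1)" "col w \<noteq> c - 1 \<Longrightarrow> row w' = row w"
proof -
  have "n dvd (w' - w - a2) + (w - (row w * a1 + col w * a2))"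
    using d coord by (intro dvd_add) auto
  then have 1: "n dvd w' - (row w * a1 + (col w + 1) * a2)" by (simp add: algebra_simps)
  have 2: "row w' = row w \<and> col w' = col w + 1" if "col w \<noteq> c - 1"
    using that coord_eqI[OF _ _ 1] coord[of w] by auto
  then show "col w \<noteq> c - 1 \<Longrightarrow> row w' = row w" by simp
  have "col w' = 0" if "col w = c - 1"
  proof -
    have "c dvd w' - (row w * a1 + c * a2)" using 1 that c_dvd_if_n_dvd by simp
    then have "c dvd w'" using c_dvd_a1
      by (metis dvd_add dvd_diff_left_iff dvd_mult dvd_triv_left)
    then show ?thesis using col_iff[of 0 w'] c2 by simp
  qed
  then show "col w' = (if col w = c - 1 then 0 else col w + 1)" using 2 by simp
qed

end

section \<open>The lower bound\<close>

context stripes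
begin

definition hor :: "(int \<Rightarrow> int) \<Rightarrow> int \<Rightarrow> bool" where
  "hor T k \<longleftrightarrow> n dvd T (k + 1) - T k - a2 \<or> n dvd T (k + 1) - T k + a2"

text \<open>A tour unrolled over all integers, with times and vertices both read modulo
  \<open>n\<close>. The equivalence expresses periodicity and injectivity at once, and it survives
  time shifts, time reversal and translation of the vertices.\<close>

definition walk :: "(int \<Rightarrow> int) \<Rightarrow> bool" where
  "walk T \<longleftrightarrow> (\<forall>k l. n dvd T k - T l \<longleftrightarrow> n dvd k - l) \<and>
     (\<forall>k. n dvd T (k + 1) - T k - a1 \<or> n dvd T (k + 1) - T k + a1 \<or> hor T k)"

definition hcost :: "(int \<Rightarrow> int) \<Rightarrow> nat" where
  "hcost T = card {k\<in>{0..<n}. hor T k}"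

text \<open>Step \<open>k\<close> of the walk uses, in either direction, an edge between the columns
  \<open>y\<close> and \<open>y + 1\<close> (taken modulo \<open>c\<close>).\<close>

definition cross :: "(int \<Rightarrow> int) \<Rightarrow> int \<Rightarrow> int \<Rightarrow> bool" where
  "cross T y k \<longleftrightarrow> n dvd T (k + 1) - T k - a2 \<and> c dvd T k - y * a2 \<or>
     n dvd T (k + 1) - T k + a2 \<and> c dvd T (k + 1) - y * a2"

lemma walk_dvd_iff: "walk T \<Longrightarrow> n dvd T k - T l \<longleftrightarrow> n dvd k - l"
  unfolding walk_def by blast

lemma walk_surj:
  assumes T: "walk T"
  shows "\<exists>j\<in>{0..<n}. n dvd T (s + j) - w"
proof -
  let ?f = "\<lambda>j. T (s + j) mod n"
  have "inj_on ?f {0..<n}"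
  proof (rule inj_onI)
    fix i j assume ij: "i \<in> {0..<n}" "j \<in> {0..<n}" and "?f i = ?f j"
    then have "n dvd i - j" using walk_dvd_iff[OF T, of "s + i" "s + j"] by (simp add: mod_eq_dvd_iff)
    then show "i = j" using ij zdvd_imp_le[of n "i - j"] zdvd_imp_le[of n "j - i"]
      by (force simp: dvd_diff_commute)
  qed
  then have "?f ` {0..<n} = {0..<n}"
    using n_ge4 by (intro endo_inj_surj) auto
  moreover have "w mod n \<in> {0..<n}" using n_ge4 by simp
  ultimately have "w mod n \<in> ?f ` {0..<n}" by argo
  then obtain j where "j \<in> {0..<n}" "T (s + j) mod n = w mod n" by auto
  then show ?thesis by (auto simp: mod_eq_dvd_iff)
qed

lemma hor_mod:
  assumes T: "walk T"
  shows "hor T (k mod n) \<longleftrightarrow> hor T k" and "cross T y (k mod n) \<longleftrightarrow> cross T y k"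
proof -
  have "n dvd k mod n - k" by (simp add: mod_eq_dvd_iff[symmetric])
  then have 1: "n dvd T (k mod n) - T k" "n dvd T (k mod n + 1) - T (k + 1)"
    using walk_dvd_iff[OF T] by simp_all
  then have c1: "c dvd T (k mod n) - T k" "c dvd T (k mod n + 1) - T (k + 1)"
    using c_dvd_if_n_dvd by auto
  have d: "n dvd (T (k mod n + 1) - T (k + 1)) - (T (k mod n) - T k)"
    by (rule dvd_diff[OF 1(2,1)])
  have 2: "n dvd T (k mod n + 1) - T (k mod n) - a2 \<longleftrightarrow> n dvd T (k + 1) - T k - a2"
    "n dvd T (k mod n + 1) - T (k mod n) + a2 \<longleftrightarrow> n dvd T (k + 1) - T k + a2"
    using d by (intro dvd_iff_of_dvd_diff; simp add: algebra_simps)+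
  have 3: "c dvd T (k mod n) - y * a2 \<longleftrightarrow> c dvd T k - y * a2"
    "c dvd T (k mod n + 1) - y * a2 \<longleftrightarrow> c dvd T (k + 1) - y * a2"
    using c1 by (intro dvd_iff_of_dvd_diff; simp add: algebra_simps)+
  show "hor T (k mod n) \<longleftrightarrow> hor T k" unfolding hor_def 2 ..
  show "cross T y (k mod n) \<longleftrightarrow> cross T y k" unfolding cross_def 2 3 ..
qed


text \<open>The normalised situation: the walk crosses from column \<open>c - 1\<close> to column
  \<open>0\<close> only at time \<open>-1\<close>, arriving at vertex \<open>0\<close>. Times
  \<open>0\<close> to \<open>n - 1\<close> then form a Hamiltonian path of the cylinder.\<close>

lemma cylinder_bound:
  assumes T: "walk T" and T0: "n dvd T 0" and T1: "n dvd T (-1) + a2"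
    and cut: "\<And>k. cross T (c - 1) k \<Longrightarrow> n dvd k + 1"
  obtains j where "r dvd j - x" "\<bar>j\<bar> \<le> int (hcost T)" "even (j - c)" "c \<le> int (hcost T)"
proof -
  let ?n = "nat n"
  define X where "X i = row (T (int i))" for i
  define Y where "Y i = col (T (int i))" for i
  have last: "int (?n - 1) = n - 1" using n_ge4 by simp
  have "n dvd T (n - 1) - T (-1)" using walk_dvd_iff[OF T] by simp
  from dvd_add[OF this T1] have Tl: "n dvd T (n - 1) + a2" by simp
  have "n dvd T n - T 0" using walk_dvd_iff[OF T] by simp
  from dvd_add[OF this T0] have Tn: "n dvd T n" by simp
  have hn: "hor T (n - 1)" unfolding hor_def using dvd_diff[OF Tn Tl] by (simp add: algebra_simps)
  have first: "row (T 0) = 0" "col (T 0) = 0"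
    using coord_eqI[of 0 0 "T 0"] T0 r2 c2 by auto
  have "n dvd (T (n - 1) + a2) - (c * a2 + x * a1)" using Tl twist by (rule dvd_diff)
  then have "n dvd T (n - 1) - (x * a1 + (c - 1) * a2)" by (simp add: algebra_simps)
  then have last': "row (T (n - 1)) = x" "col (T (n - 1)) = c - 1"
    using coord_eqI[of x "c - 1"] x_range c2 by auto
  have step: "col w' = col w \<and> (\<bar>row w' - row w\<bar> = 1 \<or> \<bar>row w' - row w\<bar> = r - 1) \<or>
      row w' = row w \<and> \<bar>col w' - col w\<bar> = 1"
    if k: "0 \<le> k" "k < n - 1" and w: "w = T k" "w' = T (k + 1)" for k w w'
  proof -
    \<comment> \<open>Among the times \<open>0\<close> to \<open>n - 1\<close> only the last is
      congruent to \<open>-1\<close>.\<close>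
    have nc: "\<not> cross T (c - 1) k" using cut[of k] k zdvd_imp_le[of n "k + 1"] by auto
    have cc: "c - 1 \<in> {0..<c}" using c2 by simp
    have "n dvd w' - w - a1 \<or> n dvd w' - w + a1 \<or> n dvd w' - w - a2 \<or> n dvd w' - w + a2"
      using T w unfolding walk_def hor_def by blast
    then consider "n dvd w' - w - a1" | "n dvd w - w' - a1" | "n dvd w' - w - a2" | "n dvd w - w' - a2"
      by (metis diff_add_eq diff_diff_eq2 dvd_diff_commute diff_minus_eq_add minus_diff_eq dvd_minus_iff add.commute)
    then show ?thesis
    proof cases
      case 1
      then show ?thesis using step_a1[OF 1] r2 by auto
    next
      case 2
      then show ?thesis using step_a1[OF 2] r2 by auto
    next
      case 3
      then have "col w \<noteq> c - 1" using nc w col_iff[OF cc, of w] unfolding cross_def by auto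
      then show ?thesis using step_a2[OF 3] by auto
    next
      case 4
      then have "n dvd w' - w + a2" by (metis diff_diff_eq2 diff_minus_eq_add dvd_diff_commute add.commute diff_add_eq)
      then have "col w' \<noteq> c - 1" using nc w col_iff[OF cc, of w'] unfolding cross_def by auto
      then show ?thesis using step_a2[OF 4] by auto
    qed
  qed
  have inj: "inj_on (\<lambda>i. (X i, Y i)) {..<?n}"
  proof (rule inj_onI)
    fix i j assume ij: "i \<in> {..<?n}" "j \<in> {..<?n}" and e: "(X i, Y i) = (X j, Y j)"
    have "n dvd (T (int i) - (X i * a1 + Y i * a2)) - (T (int j) - (X j * a1 + Y j * a2))"
      unfolding X_def Y_def by (intro dvd_diff coord(3))
    then have "n dvd T (int i) - T (int j)" using e by simp
    then have "n dvd int i - int j" using walk_dvd_iff[OF T] by simp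
    then show "i = j"
      using ij zdvd_imp_le[of n "int i - int j"] zdvd_imp_le[of n "int j - int i"]
      by (force simp: dvd_diff_commute)
  qed
  have "(\<lambda>i. (X i, Y i)) ` {..<?n} = {0..<r} \<times> {0..<c}"
  proof (rule card_subset_eq)
    show "(\<lambda>i. (X i, Y i)) ` {..<?n} \<subseteq> {0..<r} \<times> {0..<c}"
      using coord(1,2) unfolding X_def Y_def by auto
    show "card ((\<lambda>i. (X i, Y i)) ` {..<?n}) = card ({0..<r} \<times> {0..<c})"
      using card_image[OF inj] r2 c2 by (simp add: n_eq nat_mult_distrib)
  qed simp
  then have bij: "bij_betw (\<lambda>i. (X i, Y i)) {..<?n} ({0..<r} \<times> {0..<c})"
    using inj unfolding bij_betw_def by blast
  interpret cylinder_path r c x X Y ?n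
  proof
    fix i assume "Suc i < ?n"
    then have "0 \<le> int i" "int i < n - 1" by auto
    from step[OF this refl refl]
    show "Y (Suc i) = Y i \<and> (\<bar>X (Suc i) - X i\<bar> = 1 \<or> \<bar>X (Suc i) - X i\<bar> = r - 1) \<or>
      X (Suc i) = X i \<and> \<bar>Y (Suc i) - Y i\<bar> = 1"
      unfolding X_def Y_def by (simp add: add.commute)
  qed (use r2 c2 n_ge4 n_eq bij first last' last in \<open>simp_all add: X_def Y_def\<close>)
  have fin: "finite {k \<in> {0..<n}. hor T k}" by (rule finite_subset[of _ "{0..<n}"]) auto
  \<comment> \<open>The closing step \<open>n - 1\<close> is horizontal but not part of the path;
    leaving it out absorbs the \<open>+ 1\<close> of \<open>shift_bound\<close>.\<close>
  have sub: "int ` horiz \<subseteq> {k \<in> {0..<n}. hor T k} - {n - 1}"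
  proof
    fix k assume "k \<in> int ` horiz"
    then obtain i where i: "k = int i" "Suc i < ?n" "col (T (k + 1)) \<noteq> col (T k)"
      unfolding horiz_def Y_def by (auto simp: add.commute)
    then have "\<not> n dvd T (k + 1) - T k - a1" "\<not> n dvd T k - T (k + 1) - a1"
      using step_a1(1) by metis+
    then have "\<not> n dvd T (k + 1) - T k + a1"
      by (metis diff_diff_eq2 diff_minus_eq_add dvd_diff_commute add.commute diff_add_eq)
    then have "hor T k" using \<open>\<not> n dvd T (k + 1) - T k - a1\<close> T unfolding walk_def by blast
    then show "k \<in> {k \<in> {0..<n}. hor T k} - {n - 1}" using i by auto
  qed
  then have "card horiz \<le> card ({k \<in> {0..<n}. hor T k} - {n - 1})"
    using card_mono[OF _ sub] fin by (simp add: card_image del: atLeastLessThan_iff)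
  also have "\<dots> < hcost T"
    unfolding hcost_def using hn n_ge4 fin by (intro card_Diff1_less) auto
  finally have less: "card horiz < hcost T" .
  obtain j where "r dvd j - x" "\<bar>j\<bar> \<le> int (card horiz) + 1" "even (j - c)"
    using shift_bound .
  then show ?thesis using less card_horiz_ge that[of j] by linarith
qed


text \<open>Rotating or reversing time permutes the times modulo \<open>n\<close>.\<close>

lemma hcost_le_affine:
  assumes T: "walk T" and s: "s = 1 \<or> s = -1" and h: "\<And>k. hor T' k \<Longrightarrow> hor T (l + s * k)"
  shows "hcost T' \<le> hcost T"
  unfolding hcost_def
proof (rule card_inj_on_le)
  let ?f = "\<lambda>k. (l + s * k) mod n"
  show "inj_on ?f {k \<in> {0..<n}. hor T' k}"
  proof (rule inj_onI)
    fix i j assume ij: "i \<in> {k \<in> {0..<n}. hor T' k}" "j \<in> {k \<in> {0..<n}. hor T' k}" and "?f i = ?f j"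
    then have "n dvd i - j" using s by (auto simp: mod_eq_dvd_iff dvd_diff_commute)
    then show "i = j" using ij zdvd_imp_le[of n "i - j"] zdvd_imp_le[of n "j - i"]
      by (force simp: dvd_diff_commute)
  qed
  show "?f ` {k \<in> {0..<n}. hor T' k} \<subseteq> {k \<in> {0..<n}. hor T k}"
    using h hor_mod(1)[OF T] n_ge4 by auto
  show "finite {k \<in> {0..<n}. hor T k}" by (rule finite_subset[of _ "{0..<n}"]) auto
qed

text \<open>Translations are automorphisms of a circulant graph, so the unique crossing can be moved
  to the closing step assumed in \<open>cylinder_bound\<close>.\<close>

lemma single_cross_bound:
  assumes T: "walk T" and k0: "cross T y k0" and uniq: "\<And>k. cross T y k \<Longrightarrow> n dvd k - k0"
  obtains j where "r dvd j - x" "\<bar>j\<bar> \<le> int (hcost T)" "even (j - c)" "c \<le> int (hcost T)"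
proof -
  have steps: "n dvd T (k + 1) - T k - a1 \<or> n dvd T (k + 1) - T k + a1 \<or> hor T k" for k
    using T unfolding walk_def by blast
  have inj: "n dvd T k - T l \<longleftrightarrow> n dvd k - l" for k l using walk_dvd_iff[OF T] .
  consider (forward) "n dvd T (k0 + 1) - T k0 - a2" "c dvd T k0 - y * a2"
    | (backward) "n dvd T (k0 + 1) - T k0 + a2" "c dvd T (k0 + 1) - y * a2"
    using k0 unfolding cross_def by blast
  then show ?thesis
  proof cases
    case forward
    \<comment> \<open>Time \<open>k0\<close> becomes \<open>-1\<close> and the vertex reached
      becomes \<open>0\<close>.\<close>
    define T' where "T' k = T (k0 + 1 + k) - T (k0 + 1)" for k
    have diff: "T' k - T' l = T (k0 + 1 + k) - T (k0 + 1 + l)" for k l unfolding T'_def by simp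
    have d1: "T' (k + 1) - T' k = T ((k0 + 1 + k) + 1) - T (k0 + 1 + k)" for k
      unfolding T'_def by (simp add: algebra_simps)
    have hor': "hor T' k \<longleftrightarrow> hor T (k0 + 1 + k)" for k unfolding hor_def d1 ..
    have "walk T'"
      unfolding walk_def
    proof (intro conjI allI)
      show "n dvd T' k - T' l \<longleftrightarrow> n dvd k - l" for k l unfolding diff inj by simp
      show "n dvd T' (k + 1) - T' k - a1 \<or> n dvd T' (k + 1) - T' k + a1 \<or> hor T' k" for k
        unfolding hor' d1 by (rule steps)
    qed
    moreover have "n dvd T' 0" "n dvd T' (-1) + a2"
      using forward unfolding T'_def by (simp_all add: dvd_diff_commute algebra_simps)
    moreover have "n dvd k + 1" if "cross T' (c - 1) k" for k
    proof -
      have "c dvd T (k0 + 1) - T k0 - a2" using forward(1) c_dvd_if_n_dvd by blast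
      then have "c dvd (T (k0 + 1) - T k0 - a2) + (T k0 - y * a2) + c * a2"
        using forward(2) by (intro dvd_add) auto
      \<comment> \<open>The translation carries column \<open>y\<close> to column
        \<open>c - 1\<close>.\<close>
      then have e: "c dvd z - T (k0 + 1) - (c - 1) * a2 \<longleftrightarrow> c dvd z - y * a2" for z
        by (intro dvd_iff_of_dvd_diff) (simp add: algebra_simps dvd_diff_commute)
      have "cross T y (k0 + 1 + k)"
        using that unfolding cross_def d1 unfolding T'_def e by (simp add: add.assoc)
      then have "n dvd (k0 + 1 + k) - k0" using uniq by blast
      then show ?thesis by (simp add: add.commute)
    qed
    moreover have "hcost T' \<le> hcost T"
      by (rule hcost_le_affine[OF T, of 1 _ "k0 + 1"]) (simp_all add: hor')
    ultimately obtain j where "r dvd j - x" "\<bar>j\<bar> \<le> int (hcost T')" "even (j - c)"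
        "c \<le> int (hcost T')" "hcost T' \<le> hcost T"
      using cylinder_bound[of T'] by metis
    then show ?thesis using that[of j] by linarith
  next
    case backward
    \<comment> \<open>Time is reversed as well, so that the crossing is made forwards; step
      \<open>k\<close> of \<open>T'\<close> is step \<open>k0 - 1 - k\<close> of
      \<open>T\<close>.\<close>
    define T' where "T' k = T (k0 - k) - T k0" for k
    have diff: "T' k - T' l = T (k0 - k) - T (k0 - l)" for k l unfolding T'_def by simp
    have d1: "T' (k + 1) - T' k = - (T ((k0 - 1 - k) + 1) - T (k0 - 1 - k))" for k
      unfolding T'_def by (simp add: algebra_simps)
    have sw: "n dvd - z - a \<longleftrightarrow> n dvd z + a" "n dvd - z + a \<longleftrightarrow> n dvd z - a" for z a
      by (subst dvd_minus_iff[symmetric], simp)+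
    have hor': "hor T' k \<longleftrightarrow> hor T (k0 - 1 - k)" for k unfolding hor_def d1 sw by blast
    have "walk T'"
      unfolding walk_def
    proof (intro conjI allI)
      show "n dvd T' k - T' l \<longleftrightarrow> n dvd k - l" for k l unfolding diff inj by (simp add: dvd_diff_commute)
      show "n dvd T' (k + 1) - T' k - a1 \<or> n dvd T' (k + 1) - T' k + a1 \<or> hor T' k" for k
        unfolding hor' d1 sw using steps by blast
    qed
    moreover have "n dvd T' 0" "n dvd T' (-1) + a2"
      using backward unfolding T'_def by simp_all
    moreover have "n dvd k + 1" if "cross T' (c - 1) k" for k
    proof -
      have "c dvd T (k0 + 1) - T k0 + a2" using backward(1) c_dvd_if_n_dvd by blast
      from dvd_add[OF dvd_diff[OF backward(2) this] dvd_triv_left[of c a2]]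
      have e: "c dvd z - T k0 - (c - 1) * a2 \<longleftrightarrow> c dvd z - y * a2" for z
        by (intro dvd_iff_of_dvd_diff) (simp add: algebra_simps dvd_diff_commute)
      have "cross T y (k0 - 1 - k)"
        using that unfolding cross_def d1 sw unfolding T'_def e by (auto simp: algebra_simps)
      then have "n dvd (k0 - 1 - k) - k0" using uniq by blast
      then have "n dvd - (k + 1)" by (simp add: algebra_simps)
      then show ?thesis by (simp only: dvd_minus_iff)
    qed
    moreover have "hcost T' \<le> hcost T"
      by (rule hcost_le_affine[OF T, of "-1" _ "k0 - 1"]) (simp_all add: hor')
    ultimately obtain j where "r dvd j - x" "\<bar>j\<bar> \<le> int (hcost T')" "even (j - c)"
        "c \<le> int (hcost T')" "hcost T' \<le> hcost T"
      using cylinder_bound[of T'] by metis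
    then show ?thesis using that[of j] by linarith
  qed
qed


section \<open>Counting the crossings of each gap between columns\<close>

lemma col_const_if_not_hor:
  assumes T: "walk T" and "\<not> hor T k"
  shows "col (T (k + 1)) = col (T k)"
proof -
  have "n dvd T (k + 1) - T k - a1 \<or> n dvd T (k + 1) - T k + a1"
    using assms unfolding walk_def by blast
  then have "n dvd T (k + 1) - T k - a1 \<or> n dvd T k - T (k + 1) - a1"
    by (metis diff_diff_eq2 diff_minus_eq_add dvd_diff_commute add.commute diff_add_eq)
  then show ?thesis using step_a1(1) by metis
qed

text \<open>After a single horizontal step the other \<open>n - 1\<close> steps would stay in one
  column, although the walk visits both \<open>0\<close> and \<open>a2\<close>, in columns
  \<open>0\<close> and \<open>1\<close>.\<close>

lemma hcost_ge_2:
  assumes T: "walk T"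
  shows "hcost T \<ge> 2"
proof (rule ccontr)
  let ?H = "{k \<in> {0..<n}. hor T k}"
  assume "\<not> hcost T \<ge> 2"
  then have "card ?H \<le> Suc 0" unfolding hcost_def by simp
  moreover have "finite ?H" by (rule finite_subset[of _ "{0..<n}"]) auto
  ultimately obtain k0 where k0: "\<And>k. k \<in> ?H \<Longrightarrow> k = k0"
    by (metis card_le_Suc0_iff_eq)
  have nh: "\<not> hor T (k0 + 1 + int j)" if "int j < n - 1" for j
  proof
    assume "hor T (k0 + 1 + int j)"
    then have "(k0 + 1 + int j) mod n \<in> ?H" using hor_mod(1)[OF T] n_ge4 by simp
    then have "(k0 + 1 + int j) mod n = k0" using k0 by blast
    then have "n dvd k0 + 1 + int j - k0" by (metis dvd_minus_mod)
    then show False using that zdvd_imp_le[of n "1 + int j"] by simp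
  qed
  have const: "col (T (k0 + 1 + int j)) = col (T (k0 + 1))" if "int j < n" for j
    using that
  proof (induction j)
    case (Suc j)
    then show ?case using col_const_if_not_hor[OF T nh[of j]] by (simp add: ac_simps)
  qed simp
  have all: "col w = col (T (k0 + 1))" if w: "w \<in> {0, a2}" for w
  proof -
    obtain j where "j \<in> {0..<n}" "n dvd T (k0 + 1 + j) - w" using walk_surj[OF T] by blast
    then have "col w = col (T (k0 + 1 + j))"
      using col_iff[OF coord(2), of "T (k0 + 1 + j)"] c_dvd_if_n_dvd
      by (metis col_iff coord(2) diff_add_cancel dvd_add dvd_diff_commute add_diff_eq)
    also have "\<dots> = col (T (k0 + 1))" using const[of "nat j"] \<open>j \<in> {0..<n}\<close> by simp
    finally show ?thesis .
  qed
  have "col 0 = 0" "col a2 = 1" using col_iff[of 0 0] col_iff[of 1 a2] c2 by auto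
  then show False using all by auto
qed

text \<open>Two uncrossed gaps would separate the columns \<open>y1 + 1\<close> to \<open>y2\<close>
  from the others, making membership in this block invariant along the walk.\<close>

lemma at_most_one_gap_uncrossed:
  assumes T: "walk T" and y: "0 \<le> y1" "y1 < y2" "y2 < c"
    and nc: "\<And>k. \<not> cross T y1 k" "\<And>k. \<not> cross T y2 k"
  shows False
proof -
  let ?S = "\<lambda>k. y1 < col (T k) \<and> col (T k) \<le> y2"
  have y': "y1 \<in> {0..<c}" "y2 \<in> {0..<c}" using y by auto
  have *: "(y1 < col w' \<and> col w' \<le> y2) = (y1 < col w \<and> col w \<le> y2)"
    if "n dvd w' - w - a2" "col w \<noteq> y1" "col w \<noteq> y2" for w w'
    using step_a2(1)[OF that(1)] that(2,3) y coord(2)[of w] by auto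
  have inv: "?S (k + 1) = ?S k" for k
  proof (cases "hor T k")
    case True
    then consider "n dvd T (k + 1) - T k - a2" | "n dvd T (k + 1) - T k + a2"
      unfolding hor_def by blast
    then show ?thesis
    proof cases
      case 1
      then have "col (T k) \<noteq> y1" "col (T k) \<noteq> y2"
        using nc col_iff y' unfolding cross_def by blast+
      then show ?thesis using *[OF 1] by simp
    next
      case 2
      then have "col (T (k + 1)) \<noteq> y1" "col (T (k + 1)) \<noteq> y2"
        using nc col_iff y' unfolding cross_def by blast+
      moreover have "n dvd T k - T (k + 1) - a2"
        using 2 by (metis diff_diff_eq2 diff_minus_eq_add dvd_diff_commute add.commute diff_add_eq)
      ultimately show ?thesis using * by metis
    qed
  next
    case False
    then show ?thesis using col_const_if_not_hor[OF T] by simp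
  qed
  have S0: "?S (int j) = ?S 0" for j
  proof (induction j)
    case (Suc j)
    then show ?case using inv[of "int j"] by (simp add: ac_simps)
  qed simp
  have hit: "\<exists>j. col (T (int j)) = y" if "y \<in> {0..<c}" for y
  proof -
    obtain j where "j \<in> {0..<n}" "n dvd T (0 + j) - y * a2" using walk_surj[OF T] by blast
    then have "c dvd T (int (nat j)) - y * a2" using c_dvd_if_n_dvd by simp
    then have "col (T (int (nat j))) = y" using col_iff[OF that] by blast
    then show ?thesis by blast
  qed
  obtain i j where "col (T (int i)) = y1" "col (T (int j)) = y2" using hit y' by blast
  then show False using S0[of i] S0[of j] y by simp
qed

lemma exists_single_cross:
  assumes T: "walk T" and less: "int (hcost T) < 2 * c - 2"
  obtains y k0 where "cross T y k0" "\<And>k. cross T y k \<Longrightarrow> n dvd k - k0"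
proof -
  let ?G = "\<lambda>y. {k \<in> {0..<n}. cross T y k}"
  \<comment> \<open>For \<open>c = 2\<close> the two gaps join the same pair of columns; the cost
    bound rules this case out.\<close>
  have c3: "c > 2" using hcost_ge_2[OF T] less by linarith
  have fin: "finite {k \<in> {0..<n}. P k}" for P by (rule finite_subset[of _ "{0..<n}"]) auto
  have mem: "cross T y k \<longleftrightarrow> k mod n \<in> ?G y" for y k
    using hor_mod(2)[OF T] n_ge4 by simp
  have both: False if "n dvd z - a2" "n dvd z + a2" for z
  proof -
    have "c dvd (z + a2) - (z - a2)" by (rule dvd_diff[OF that(2,1)[THEN c_dvd_if_n_dvd]])
    then have "c dvd 2 * a2" by (simp add: algebra_simps)
    then have "c dvd 2" using gcd_c_a2 by (simp add: coprime_dvd_mult_left_iff coprime_iff_gcd_eq_1)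
    then show False using c3 zdvd_imp_le[of c 2] by simp
  qed
  have disj: "?G y \<inter> ?G y' = {}" if "y \<in> {0..<c}" "y' \<in> {0..<c}" "y \<noteq> y'" for y y'
  proof -
    have "\<not> (cross T y k \<and> cross T y' k)" for k
      using both that(3) unfolding cross_def col_iff[OF that(1)] col_iff[OF that(2)] by metis
    then show ?thesis by blast
  qed
  have "(\<Sum>y\<in>{0..<c}. card (?G y)) = card (\<Union>y\<in>{0..<c}. ?G y)"
    using disj fin by (intro card_UN_disjoint[symmetric]) (auto simp del: atLeastLessThan_iff)
  also have "\<dots> \<le> hcost T"
    unfolding hcost_def by (intro card_mono fin) (auto simp: cross_def hor_def)
  finally have sum_le: "(\<Sum>y\<in>{0..<c}. card (?G y)) \<le> hcost T" .
  have "\<exists>y\<in>{0..<c}. card (?G y) = 1"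
  proof (rule ccontr)
    assume none: "\<not> (\<exists>y\<in>{0..<c}. card (?G y) = 1)"
    have empty: "\<not> cross T y k" if "card (?G y) = 0" for y k
      using that fin mem[of y k] by (metis card_0_eq empty_iff)
    have one_zero: "y = y'" if "y \<in> {0..<c}" "y' \<in> {0..<c}" "card (?G y) = 0" "card (?G y') = 0" for y y'
      using at_most_one_gap_uncrossed[OF T, of y y'] at_most_one_gap_uncrossed[OF T, of y' y]
        empty[OF that(3)] empty[OF that(4)] that(1,2) by (metis atLeastLessThan_iff linorder_neqE)
    \<comment> \<open>\<open>y0\<close> is the only gap that may be uncrossed; each of the other
      \<open>c - 1\<close> gaps is crossed at least twice.\<close>
    obtain y0 where y0: "y0 \<in> {0..<c}" "\<And>y. y \<in> {0..<c} - {y0} \<Longrightarrow> card (?G y) \<noteq> 0"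
    proof (cases "\<exists>y\<in>{0..<c}. card (?G y) = 0")
      case True
      then obtain y0 where "y0 \<in> {0..<c}" "card (?G y0) = 0" by blast
      then show ?thesis using one_zero that by blast
    next
      case False
      then show ?thesis using that[of 0] c2 by auto
    qed
    have "(\<Sum>y\<in>{0..<c} - {y0}. 2) \<le> (\<Sum>y\<in>{0..<c} - {y0}. card (?G y))"
    proof (rule sum_mono)
      fix y assume y: "y \<in> {0..<c} - {y0}"
      then have "card (?G y) \<noteq> 0" "card (?G y) \<noteq> 1" using y0(2) none by blast+
      then show "2 \<le> card (?G y)" by linarith
    qed
    also have "\<dots> \<le> (\<Sum>y\<in>{0..<c}. card (?G y))" by (rule sum_mono2) auto
    also note sum_le
    finally have "card ({0..<c} - {y0}) * 2 \<le> hcost T" by (simp only: sum_constant of_nat_id)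
    moreover have "card ({0..<c} - {y0}) = nat c - 1" using y0(1) by (simp add: card_Diff_singleton)
    ultimately show False using less c2 by linarith
  qed
  then obtain y k0 where k0: "?G y = {k0}" by (metis card_1_singletonE)
  then have "k0 \<in> ?G y" by blast
  then have "k0 mod n = k0" "cross T y k0" by simp_all
  moreover have "n dvd k - k0" if "cross T y k" for k
  proof -
    have "k mod n = k0" using that mem[of y k] unfolding k0 by blast
    then show ?thesis using \<open>k0 mod n = k0\<close> by (metis mod_eq_dvd_iff)
  qed
  ultimately show ?thesis using that by blast
qed

lemma walk_bound:
  assumes T: "walk T" and less: "int (hcost T) < 2 * c - 2"
  obtains j where "r dvd j - x" "\<bar>j\<bar> \<le> int (hcost T)" "even (j - c)" "c \<le> int (hcost T)"
  using exists_single_cross[OF assms] single_cross_bound[OF T] by metis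

end

section \<open>Paths made of strips of columns\<close>

fun path_edges :: "'a list \<Rightarrow> 'a set set" where
  "path_edges (p # q # ps) = insert {p, q} (path_edges (q # ps))"
| "path_edges _ = {}"

lemma nth_path_edges: "Suc i < length t \<Longrightarrow> {t ! i, t ! Suc i} \<in> path_edges t"
proof (induction t arbitrary: i rule: path_edges.induct)
  case (1 p q ps)
  then show ?case by (cases i) auto
qed auto

lemma finite_path_edges [simp]: "finite (path_edges t)"
  by (induction t rule: path_edges.induct) auto

lemma cycle_edges_subset: "t \<noteq> [] \<Longrightarrow> cycle_edges t \<subseteq> insert {last t, hd t} (path_edges t)"
proof
  fix e assume t: "t \<noteq> []" and "e \<in> cycle_edges t"
  then obtain i where i: "e = {t ! i, t ! (Suc i mod length t)}" "i < length t"
    unfolding cycle_edges_def by blast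
  show "e \<in> insert {last t, hd t} (path_edges t)"
  proof (cases "Suc i < length t")
    case True
    then show ?thesis using i nth_path_edges[OF True] by simp
  next
    case False
    then have "Suc i = length t" using i by simp
    then have "e = {last t, hd t}" using i t by (auto simp: last_conv_nth hd_conv_nth dest: sym)
    then show ?thesis by simp
  qed
qed

text \<open>Paths are built in the plane grid with unreduced rows, which avoids wrap-around cases;
  rows are identified modulo \<open>r\<close> only on passing to vertices.\<close>

definition adj :: "int \<times> int \<Rightarrow> int \<times> int \<Rightarrow> bool" where
  "adj p q \<longleftrightarrow> snd p = snd q \<and> \<bar>fst p - fst q\<bar> = 1 \<or> fst p = fst q \<and> \<bar>snd p - snd q\<bar> = 1"

lemma adj_iff: "adj (a, b) (a', b') \<longleftrightarrow> b = b' \<and> \<bar>a - a'\<bar> = 1 \<or> a = a' \<and> \<bar>b - b'\<bar> = 1"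
  unfolding adj_def by simp

fun hsteps :: "(int \<times> int) list \<Rightarrow> nat" where
  "hsteps (p # q # ps) = (if snd p = snd q then 0 else 1) + hsteps (q # ps)"
| "hsteps _ = 0"

lemma hsteps_append:
  assumes "ps \<noteq> []" "qs \<noteq> []"
  shows "hsteps (ps @ qs) = hsteps ps + (if snd (last ps) = snd (hd qs) then 0 else 1) + hsteps qs"
  using assms(1)
proof (induction ps rule: hsteps.induct)
  case ("2_2" p)
  then show ?case using assms(2) by (cases qs) auto
qed auto

lemma hsteps_le: "hsteps ps \<le> length ps - 1"
  by (induction ps rule: hsteps.induct) auto

lemma hsteps_const: "(\<And>p. p \<in> set ps \<Longrightarrow> snd p = y) \<Longrightarrow> hsteps ps = 0"
  by (induction ps rule: hsteps.induct) auto

definition seg :: "int \<Rightarrow> int \<Rightarrow> int \<Rightarrow> nat \<Rightarrow> (int \<times> int) list" where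
  "seg i y s m = map (\<lambda>j. (i + s * int j, y)) [0..<m]"

lemma length_seg [simp]: "length (seg i y s m) = m" unfolding seg_def by simp

lemma seg_eq_Nil_iff [simp]: "seg i y s m = [] \<longleftrightarrow> m = 0" unfolding seg_def by simp

lemma hd_seg [simp]: "m > 0 \<Longrightarrow> hd (seg i y s m) = (i, y)"
  unfolding seg_def by (simp add: hd_map)

lemma last_seg [simp]: "m > 0 \<Longrightarrow> last (seg i y s m) = (i + s * (int m - 1), y)"
  unfolding seg_def by (simp add: last_map of_nat_diff)

lemma hsteps_seg [simp]: "hsteps (seg i y s m) = 0"
  by (rule hsteps_const[of _ y]) (auto simp: seg_def)

lemma adj_seg [simp]: "s = 1 \<or> s = -1 \<Longrightarrow> successively adj (seg i y s m)"
  unfolding successively_conv_nth by (auto simp: seg_def adj_def algebra_simps)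

lemma mem_seg: "(u, v) \<in> set (seg i y s m) \<longleftrightarrow> v = y \<and> (\<exists>j. 0 \<le> j \<and> j < int m \<and> u = i + s * j)"
proof
  assume "v = y \<and> (\<exists>j. 0 \<le> j \<and> j < int m \<and> u = i + s * j)"
  then obtain j where "v = y" "0 \<le> j" "j < int m" "u = i + s * j" by blast
  then show "(u, v) \<in> set (seg i y s m)" unfolding seg_def by (auto intro!: image_eqI[of _ _ "nat j"])
next
  assume "(u, v) \<in> set (seg i y s m)"
  then obtain j where "j < m" "v = y" "u = i + s * int j" unfolding seg_def by auto
  then show "v = y \<and> (\<exists>j. 0 \<le> j \<and> j < int m \<and> u = i + s * j)"
    by (intro conjI exI[of _ "int j"]) auto
qed

text \<open>The start \<open>l\<close> is left free because the second column of a zigzag is covered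
  from offset \<open>r - 3\<close> on.\<close>

lemma residue_in_window:
  fixes r :: int
  assumes "r > 0" "s = 1 \<or> s = -1"
  obtains j where "l \<le> j" "j < l + r" "r dvd (i + s * j) - u"
proof
  let ?j = "l + (s * (u - i) - l) mod r"
  show "l \<le> ?j" "?j < l + r" using assms by simp_all
  have "r dvd (s * (u - i) - l) - (s * (u - i) - l) mod r" by (rule dvd_minus_mod)
  then have "r dvd s * (u - i) - ?j" by (simp add: algebra_simps)
  then have "r dvd s * (s * (u - i) - ?j)" by (rule dvd_mult)
  moreover have "s * (s * (u - i) - ?j) = u - (i + s * ?j)"
    using assms(2) by (auto simp: algebra_simps)
  ultimately show "r dvd (i + s * ?j) - u" by (simp only: dvd_diff_commute)
qed

text \<open>A path through \<open>k\<close> adjacent columns with net row shift \<open>d\<close>.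
  \<open>H\<close> includes the step leaving the strip, so that costs add under concatenation. The
  length together with the covering condition means that each vertex is visited exactly once modulo
  \<open>r\<close>.\<close>

definition strip :: "int \<Rightarrow> nat \<Rightarrow> int \<Rightarrow> nat \<Rightarrow> bool" where
  "strip r k d H \<longleftrightarrow> (\<forall>i y. \<exists>ps. ps \<noteq> [] \<and> hd ps = (i, y) \<and> last ps = (i + d, y + int k - 1) \<and>
     length ps = nat r * k \<and> successively adj ps \<and> hsteps ps + 1 = H \<and>
     (\<forall>v\<in>{y..<y + int k}. \<forall>u. \<exists>u'. (u', v) \<in> set ps \<and> r dvd u' - u))"

lemma strip_add:
  assumes 1: "strip r k d H" and 2: "strip r k' d' H'"
  shows "strip r (k + k') (d + d') (H + H')"
  unfolding strip_def
proof (intro allI)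
  fix i y
  obtain ps where ps: "ps \<noteq> []" "hd ps = (i, y)" "last ps = (i + d, y + int k - 1)"
    "length ps = nat r * k" "successively adj ps" "hsteps ps + 1 = H"
    and cp: "\<And>v u. v \<in> {y..<y + int k} \<Longrightarrow> \<exists>u'. (u', v) \<in> set ps \<and> r dvd u' - u"
    using 1 unfolding strip_def by metis
  obtain qs where qs: "qs \<noteq> []" "hd qs = (i + d, y + int k)"
    "last qs = (i + d + d', y + int k + int k' - 1)"
    "length qs = nat r * k'" "successively adj qs" "hsteps qs + 1 = H'"
    and cq: "\<And>v u. v \<in> {y + int k..<y + int k + int k'} \<Longrightarrow> \<exists>u'. (u', v) \<in> set qs \<and> r dvd u' - u"
    using 2 unfolding strip_def by metis
  have "\<exists>u'. (u', v) \<in> set (ps @ qs) \<and> r dvd u' - u" if "v \<in> {y..<y + int (k + k')}" for v u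
  proof (cases "v < y + int k")
    case True
    then show ?thesis using cp[of v u] that by auto
  next
    case False
    then show ?thesis using cq[of v u] that by auto
  qed
  then show "\<exists>ps. ps \<noteq> [] \<and> hd ps = (i, y) \<and> last ps = (i + (d + d'), y + int (k + k') - 1) \<and>
     length ps = nat r * (k + k') \<and> successively adj ps \<and> hsteps ps + 1 = H + H' \<and>
     (\<forall>v\<in>{y..<y + int (k + k')}. \<forall>u. \<exists>u'. (u', v) \<in> set ps \<and> r dvd u' - u)"
    using ps qs
    by (intro exI[of _ "ps @ qs"])
      (simp add: hsteps_append successively_append_iff adj_def algebra_simps)
qed

text \<open>The path stops one short of a full turn, a shift of \<open>- s\<close> modulo
  \<open>r\<close>.\<close>

lemma strip_column:
  assumes "r > 0" and s: "s = 1 \<or> s = -1"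
  shows "strip r 1 (s * (r - 1)) 1"
  unfolding strip_def
proof (intro allI)
  fix i y
  have "\<exists>u'. (u', y) \<in> set (seg i y s (nat r)) \<and> r dvd u' - u" for u
    using residue_in_window[OF assms, of 0 i u] assms(1) unfolding mem_seg by (metis add_0 nat_0_le order_less_imp_le)
  then show "\<exists>ps. ps \<noteq> [] \<and> hd ps = (i, y) \<and> last ps = (i + s * (r - 1), y + int 1 - 1) \<and>
     length ps = nat r * 1 \<and> successively adj ps \<and> hsteps ps + 1 = 1 \<and>
     (\<forall>v\<in>{y..<y + int 1}. \<forall>u. \<exists>u'. (u', v) \<in> set ps \<and> r dvd u' - u)"
    using assms by (intro exI[of _ "seg i y s (nat r)"]) auto
qed

text \<open>Two columns crossed by three horizontal steps: relative to two single columns, two extra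
  horizontal steps change the row shift modulo \<open>r\<close> by two more.\<close>

lemma strip_zigzag:
  assumes r: "r \<ge> 3" and s: "s = 1 \<or> s = -1"
  shows "strip r 2 (s * (2 * r - 4)) 4"
  unfolding strip_def
proof (intro allI)
  fix i y
  \<comment> \<open>In direction \<open>s\<close> the first column receives the offsets
    \<open>0\<close> to \<open>r - 3\<close>, then \<open>r - 2\<close> and \<open>r - 1\<close>;
    the second receives \<open>r - 3\<close> and \<open>r - 2\<close>, then \<open>r - 1\<close> to
    \<open>2 * r - 4\<close>. Each is a window of \<open>r\<close> consecutive rows.\<close>
  let ?ps = "seg i y s (nat (r - 2)) @ seg (i + s * (r - 3)) (y + 1) s 2 @
    seg (i + s * (r - 2)) y s 2 @ seg (i + s * (r - 1)) (y + 1) s (nat (r - 2))"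
  have r0: "r > 0" using r by simp
  have len: "length ?ps = nat r * 2" using r by simp
  have "\<exists>u'. (u', v) \<in> set ?ps \<and> r dvd u' - u" if "v \<in> {y..<y + int 2}" for u v
  proof -
    have "v = y \<or> v = y + 1" using that by auto
    then consider "v = y" | "v = y + 1" by blast
    then show ?thesis
    proof cases
      case 1
      obtain j where j: "0 \<le> j" "j < 0 + r" "r dvd (i + s * j) - u"
        using residue_in_window[OF r0 s] .
      have "(i + s * j, y) \<in> set ?ps"
      proof (cases "j < r - 2")
        case True
        then have "(i + s * j, y) \<in> set (seg i y s (nat (r - 2)))"
          using j unfolding mem_seg by (intro conjI exI[of _ j]) auto
        then show ?thesis by simp
      next
        case False
        then have "(i + s * j, y) \<in> set (seg (i + s * (r - 2)) y s 2)"
          using j unfolding mem_seg by (intro conjI exI[of _ "j - (r - 2)"]) (auto simp: algebra_simps)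
        then show ?thesis by simp
      qed
      then show ?thesis using j 1 by blast
    next
      case 2
      obtain j where j: "r - 3 \<le> j" "j < r - 3 + r" "r dvd (i + s * j) - u"
        using residue_in_window[OF r0 s] .
      have "(i + s * j, y + 1) \<in> set ?ps"
      proof (cases "j < r - 1")
        case True
        then have "(i + s * j, y + 1) \<in> set (seg (i + s * (r - 3)) (y + 1) s 2)"
          using j unfolding mem_seg by (intro conjI exI[of _ "j - (r - 3)"]) (auto simp: algebra_simps)
        then show ?thesis by simp
      next
        case False
        then have "(i + s * j, y + 1) \<in> set (seg (i + s * (r - 1)) (y + 1) s (nat (r - 2)))"
          using j unfolding mem_seg by (intro conjI exI[of _ "j - (r - 1)"]) (auto simp: algebra_simps)
        then show ?thesis by simp
      qed
      then show ?thesis using j 2 by blast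
    qed
  qed
  then show "\<exists>ps. ps \<noteq> [] \<and> hd ps = (i, y) \<and> last ps = (i + s * (2 * r - 4), y + int 2 - 1) \<and>
     length ps = nat r * 2 \<and> successively adj ps \<and> hsteps ps + 1 = 4 \<and>
     (\<forall>v\<in>{y..<y + int 2}. \<forall>u. \<exists>u'. (u', v) \<in> set ps \<and> r dvd u' - u)"
    using r s len
    by (intro exI[of _ ?ps])
      (simp add: hsteps_append successively_append_iff adj_iff, simp add: algebra_simps)
qed

text \<open>\<open>S\<close> is the sum of the directions \<open>1\<close> or \<open>-1\<close>
  chosen in the columns; the shift is \<open>- S\<close> modulo \<open>r\<close>.\<close>

lemma strip_columns:
  assumes "r > 0" and "k > 0" and "\<bar>S\<bar> \<le> int k" "even (S - int k)"
  shows "strip r k (S * (r - 1)) k"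
  using assms(2-4)
proof (induction k arbitrary: S)
  case (Suc k)
  show ?case
  proof (cases "k = 0")
    case True
    then have "S = 1 \<or> S = -1" using Suc.prems by (auto simp: abs_if split: if_splits) presburger+
    then show ?thesis using strip_column[OF assms(1), of S] True by simp
  next
    case False
    \<comment> \<open>Upwards unless all directions must be \<open>-1\<close>; by parity this keeps
      the remaining sum within the bound \<open>k\<close>.\<close>
    define s :: int where "s = (if S = - int (Suc k) then -1 else 1)"
    have s: "s = 1 \<or> s = -1" unfolding s_def by simp
    have "\<bar>S - s\<bar> \<le> int k" "even (S - s - int k)"
      using Suc.prems unfolding s_def by (auto simp: abs_if split: if_splits) presburger+
    then have "strip r k ((S - s) * (r - 1)) k" using Suc.IH False by simp
    from strip_add[OF this strip_column[OF assms(1) s]]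
    show ?thesis by (simp add: algebra_simps)
  qed
qed simp

text \<open>With all parts in the same direction the shift is \<open>- s * (e + 4 * m)\<close>
  modulo \<open>r\<close>, of the same size as the cost.\<close>

lemma strip_zigzags:
  assumes "r \<ge> 3" and s: "s = 1 \<or> s = -1" and "e > 0"
  shows "strip r (e + 2 * m) (s * (int e * (r - 1) + int m * (2 * r - 4))) (e + 4 * m)"
proof (induction m)
  case 0
  show ?case using strip_columns[of r e "s * int e"] assms by (auto simp: algebra_simps)
next
  case (Suc m)
  from strip_add[OF Suc strip_zigzag[OF assms(1) s]] show ?case
    by (simp add: algebra_simps)
qed

text \<open>Row \<open>0\<close> is left free for the return. The snake ends in row \<open>1\<close>
  or \<open>r - 1\<close>, and both are adjacent to row \<open>0\<close> on the cylinder.\<close>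

lemma snake:
  assumes r: "r \<ge> 2" and "k > 0"
  shows "\<exists>ps. ps \<noteq> [] \<and> hd ps = (1, 0) \<and> last ps \<in> {(1, int k - 1), (r - 1, int k - 1)} \<and>
     length ps = nat (r - 1) * k \<and> successively adj ps \<and> hsteps ps + 1 = k \<and>
     (\<forall>v\<in>{0..<int k}. \<forall>u\<in>{1..<r}. (u, v) \<in> set ps)"
  using assms(2)
proof (induction k)
  case (Suc k)
  have up: "(u, y) \<in> set (seg 1 y 1 (nat (r - 1)))" if "u \<in> {1..<r}" for u y
    using that unfolding mem_seg by (intro conjI exI[of _ "u - 1"]) auto
  have down: "(u, y) \<in> set (seg (r - 1) y (-1) (nat (r - 1)))" if "u \<in> {1..<r}" for u y
    using that unfolding mem_seg by (intro conjI exI[of _ "r - 1 - u"]) auto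
  show ?case
  proof (cases "k = 0")
    case True
    have "(u, v) \<in> set (seg 1 0 1 (nat (r - 1)))" if "v \<in> {0..<int (Suc k)}" "u \<in> {1..<r}" for u v
    proof -
      have "v = 0" using that True by auto
      then show ?thesis using up that by blast
    qed
    then show ?thesis using r True
      by (intro exI[of _ "seg 1 0 1 (nat (r - 1))"]) simp
  next
    case False
    then obtain ps where ps: "ps \<noteq> []" "hd ps = (1, 0)"
      "last ps \<in> {(1, int k - 1), (r - 1, int k - 1)}" "length ps = nat (r - 1) * k"
      "successively adj ps" "hsteps ps + 1 = k"
      "\<forall>v\<in>{0..<int k}. \<forall>u\<in>{1..<r}. (u, v) \<in> set ps"
      using Suc.IH by blast
    \<comment> \<open>The new column is traversed away from the row in which the previous one
      ended.\<close>
    define qs where "qs = (if last ps = (1, int k - 1) then seg 1 (int k) 1 (nat (r - 1))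
      else seg (r - 1) (int k) (-1) (nat (r - 1)))"
    have qs: "qs \<noteq> []" "hd qs = (fst (last ps), int k)" "snd (last ps) = int k - 1"
      "last qs \<in> {(1, int k), (r - 1, int k)}" "length qs = nat (r - 1)"
      "successively adj qs" "hsteps qs = 0" "\<And>u. u \<in> {1..<r} \<Longrightarrow> (u, int k) \<in> set qs"
      using ps(3) r up down unfolding qs_def by auto
    have "(u, v) \<in> set (ps @ qs)" if "v \<in> {0..<int (Suc k)}" "u \<in> {1..<r}" for u v
    proof (cases "v < int k")
      case True
      then show ?thesis using ps(7) that by auto
    next
      case False
      then have "v = int k" using that by simp
      then show ?thesis using qs(8) that by auto
    qed
    then show ?thesis using ps(1-6) qs(1-7)
      by (intro exI[of _ "ps @ qs"])
        (auto simp: hsteps_append successively_append_iff adj_def)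
  qed
qed simp


section \<open>Tours\<close>

context stripes
begin

section \<open>From tours to periodic walks\<close>

lemma stripe_edgesD:
  assumes "{v, w} \<in> stripe_edges n a"
  shows "n dvd w - v - a \<or> n dvd w - v + a"
proof -
  obtain v' w' where e: "{v, w} = {v', w'}" and w': "w' = (v' + a) mod n \<or> w' = (v' - a) mod n"
    using assms unfolding stripe_edges_def by blast
  have "n dvd w' - (v' + a) \<or> n dvd w' - (v' - a)"
    using w' by (metis mod_eq_dvd_iff mod_mod_trivial)
  then have "n dvd w' - v' - a \<or> n dvd w' - v' + a" by (simp add: algebra_simps)
  moreover have "n dvd v' - w' - a \<or> n dvd v' - w' + a"
    using calculation by (metis diff_diff_eq2 diff_minus_eq_add dvd_diff_commute add.commute diff_add_eq)
  ultimately show ?thesis using e by (auto simp: doubleton_eq_iff)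
qed

lemma stripe_edgesI:
  assumes "v \<in> {0..<n}" "w \<in> {0..<n}" "n dvd w - v - a \<or> n dvd w - v + a"
  shows "{v, w} \<in> stripe_edges n a"
proof -
  have "n dvd w - (v + a) \<or> n dvd w - (v - a)" using assms(3) by (simp add: algebra_simps)
  then have "w mod n = (v + a) mod n \<or> w mod n = (v - a) mod n" by (simp add: mod_eq_dvd_iff)
  moreover have "w mod n = w" using assms(2) by simp
  ultimately show ?thesis using assms(1) unfolding stripe_edges_def by auto
qed

text \<open>An edge of length \<open>a1\<close> has difference divisible by \<open>c\<close>,
  whereas \<open>c\<close> does not divide \<open>a2\<close>.\<close>

lemma stripes_disjoint: "{v, w} \<in> stripe_edges n a1 \<Longrightarrow> {v, w} \<notin> stripe_edges n a2"
proof
  assume "{v, w} \<in> stripe_edges n a1" "{v, w} \<in> stripe_edges n a2"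
  then have d: "n dvd w - v - a1 \<or> n dvd w - v + a1" "n dvd w - v - a2 \<or> n dvd w - v + a2"
    using stripe_edgesD by auto
  have "c dvd w - v"
    using d(1) c_dvd_if_n_dvd c_dvd_a1 by (metis dvd_add_left_iff dvd_diff_left_iff)
  then have "c dvd a2" using d(2) c_dvd_if_n_dvd by (metis dvd_add_right_iff dvd_diff_right_iff)
  then show False using gcd_c_a2 c2 by (simp add: gcd_proj1_if_dvd)
qed

lemma tour_imp_walk:
  assumes "tour n a1 a2 t"
  obtains T where "walk T" "int (hcost T) \<le> tour_cost n a2 t"
proof
  have t: "distinct t" "set t = {0..<n}" "cycle_edges t \<subseteq> stripe_edges n a1 \<union> stripe_edges n a2"
    using assms unfolding tour_def hamiltonian_cycle_def by auto
  have len: "length t = nat n" using distinct_card[OF t(1)] t(2) by simp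
  define T where "T k = t ! nat (k mod n)" for k
  have idx: "nat (k mod n) < length t" for k using n_ge4 len by simp
  have T_in: "T k \<in> {0..<n}" for k using nth_mem[OF idx] t(2) unfolding T_def by blast
  have T_eq: "T k = T l \<longleftrightarrow> n dvd k - l" for k l
  proof -
    have "T k = T l \<longleftrightarrow> nat (k mod n) = nat (l mod n)"
      unfolding T_def using nth_eq_iff_index_eq[OF t(1) idx idx] .
    also have "\<dots> \<longleftrightarrow> k mod n = l mod n" using n_ge4 by (simp add: eq_nat_nat_iff)
    finally show ?thesis by (simp add: mod_eq_dvd_iff)
  qed
  have edge: "{T k, T (k + 1)} \<in> cycle_edges t" for k
  proof -
    have "(k + 1) mod n = (k mod n + 1) mod n" by (simp add: mod_simps)
    then have "nat ((k + 1) mod n) = Suc (nat (k mod n)) mod length t"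
      using n_ge4 len by (simp add: nat_mod_distrib Suc_nat_eq_nat_zadd1 add.commute)
    then show ?thesis unfolding cycle_edges_def T_def using idx by auto
  qed
  show w: "walk T"
    unfolding walk_def
  proof (intro conjI allI)
    fix k l
    have "n dvd T k - T l \<longleftrightarrow> T k mod n = T l mod n" by (simp add: mod_eq_dvd_iff)
    also have "\<dots> \<longleftrightarrow> T k = T l" using T_in[of k] T_in[of l] by simp
    finally show "n dvd T k - T l \<longleftrightarrow> n dvd k - l" using T_eq by simp
  next
    fix k
    have "{T k, T (k + 1)} \<in> stripe_edges n a1 \<union> stripe_edges n a2" using edge t(3) by blast
    then show "n dvd T (k + 1) - T k - a1 \<or> n dvd T (k + 1) - T k + a1 \<or> hor T k"
      unfolding hor_def using stripe_edgesD by blast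
  qed
  have "card {k \<in> {0..<n}. hor T k} \<le> card (cycle_edges t \<inter> stripe_edges n a2)"
  proof (rule card_inj_on_le)
    show "inj_on (\<lambda>k. {T k, T (k + 1)}) {k \<in> {0..<n}. hor T k}"
    proof (rule inj_onI)
      fix k l assume kl: "k \<in> {k \<in> {0..<n}. hor T k}" "l \<in> {k \<in> {0..<n}. hor T k}"
        and "{T k, T (k + 1)} = {T l, T (l + 1)}"
      then consider "T k = T l" | "T k = T (l + 1)" "T (k + 1) = T l" by (auto simp: doubleton_eq_iff)
      then show "k = l"
      proof cases
        case 1
        then show ?thesis using kl T_eq[of k l] zdvd_imp_le[of n "k - l"] zdvd_imp_le[of n "l - k"]
          by (force simp: dvd_diff_commute)
      next
        \<comment> \<open>An edge traversed in both directions would give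
          \<open>n dvd 2\<close>.\<close>
        case 2
        then have "n dvd k - (l + 1)" "n dvd k + 1 - l" unfolding T_eq by blast+
        from dvd_diff[OF this(2,1)] show ?thesis using n_ge4 zdvd_imp_le[of n 2] by simp
      qed
    qed
    show "(\<lambda>k. {T k, T (k + 1)}) ` {k \<in> {0..<n}. hor T k} \<subseteq> cycle_edges t \<inter> stripe_edges n a2"
      using edge stripe_edgesI[OF T_in T_in] unfolding hor_def by blast
    show "finite (cycle_edges t \<inter> stripe_edges n a2)" unfolding cycle_edges_def by simp
  qed
  then show "int (hcost T) \<le> tour_cost n a2 t" unfolding hcost_def tour_cost_def by simp
qed

section \<open>From grid paths to tours\<close>

definition vertex :: "int \<times> int \<Rightarrow> int" where
  "vertex p = (fst p * a1 + snd p * a2) mod n"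

lemma vertex_in: "vertex p \<in> {0..<n}"
  unfolding vertex_def using n_ge4 by simp

lemma vertex_edgeI:
  assumes "n dvd (fst q - fst p) * a1 + (snd q - snd p) * a2 - a \<or>
    n dvd (fst q - fst p) * a1 + (snd q - snd p) * a2 + a"
  shows "{vertex p, vertex q} \<in> stripe_edges n a"
proof -
  let ?z = "(fst q - fst p) * a1 + (snd q - snd p) * a2"
  have v: "n dvd vertex p - (fst p * a1 + snd p * a2)" for p
    unfolding vertex_def by (simp add: mod_eq_dvd_iff[symmetric])
  have "n dvd (vertex q - (fst q * a1 + snd q * a2)) - (vertex p - (fst p * a1 + snd p * a2))"
    by (intro dvd_diff[OF v v])
  then have d: "n dvd (vertex q - vertex p) - ?z" by (simp add: algebra_simps)
  have "n dvd vertex q - vertex p + b \<longleftrightarrow> n dvd ?z + b" for b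
    by (rule dvd_iff_of_dvd_diff) (use d in \<open>simp only: add_diff_cancel_right\<close>)
  from this[of a] this[of "- a"] have "n dvd vertex q - vertex p + a \<longleftrightarrow> n dvd ?z + a"
    "n dvd vertex q - vertex p - a \<longleftrightarrow> n dvd ?z - a" by simp_all
  then show ?thesis using assms stripe_edgesI[OF vertex_in vertex_in] by blast
qed

lemma adj_edge:
  assumes "adj p q"
  shows "{vertex p, vertex q} \<in> (if snd p = snd q then stripe_edges n a1 else stripe_edges n a2)"
proof (cases "snd p = snd q")
  case True
  then have "fst q - fst p = 1 \<or> fst q - fst p = - 1" using assms unfolding adj_def by auto
  then have "{vertex p, vertex q} \<in> stripe_edges n a1"
    using True by (intro vertex_edgeI) auto
  then show ?thesis using True by simp
next
  case False
  then have "snd q - snd p = 1 \<or> snd q - snd p = - 1" "fst p = fst q" using assms unfolding adj_def by auto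
  then have "{vertex p, vertex q} \<in> stripe_edges n a2"
    by (intro vertex_edgeI) auto
  then show ?thesis using False by simp
qed

lemma path_edges_vertex:
  assumes "successively adj ps"
  shows "path_edges (map vertex ps) \<subseteq> stripe_edges n a1 \<union> stripe_edges n a2 \<and>
    card (path_edges (map vertex ps) \<inter> stripe_edges n a2) \<le> hsteps ps"
  using assms
proof (induction ps rule: hsteps.induct)
  case (1 p q ps)
  let ?E = "path_edges (map vertex (q # ps))"
  have IH: "?E \<subseteq> stripe_edges n a1 \<union> stripe_edges n a2" "card (?E \<inter> stripe_edges n a2) \<le> hsteps (q # ps)"
    and "adj p q" using 1 by auto
  note e = adj_edge[OF this(3)]
  have E: "path_edges (map vertex (p # q # ps)) = insert {vertex p, vertex q} ?E" by simp
  have fin: "finite (?E \<inter> stripe_edges n a2)" by simp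
  show ?case
  proof (cases "snd p = snd q")
    case True
    then have "{vertex p, vertex q} \<in> stripe_edges n a1" using e by simp
    moreover from this have "insert {vertex p, vertex q} ?E \<inter> stripe_edges n a2 = ?E \<inter> stripe_edges n a2"
      using stripes_disjoint by blast
    ultimately show ?thesis unfolding E using IH True by simp
  next
    case False
    then have "{vertex p, vertex q} \<in> stripe_edges n a2" using e by simp
    moreover from this have "insert {vertex p, vertex q} ?E \<inter> stripe_edges n a2 =
      insert {vertex p, vertex q} (?E \<inter> stripe_edges n a2)" by blast
    moreover have "card (insert {vertex p, vertex q} (?E \<inter> stripe_edges n a2)) \<le> Suc (card (?E \<inter> stripe_edges n a2))"
      by (rule card_insert_le_m1) simp_all
    ultimately show ?thesis unfolding E using IH False by simp
  qed
qed auto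

text \<open>Distinctness is by counting: a list of length \<open>n\<close> whose vertices exhaust
  \<open>{0..<n}\<close> has no repetition.\<close>

lemma tour_from_path:
  assumes len: "length ps = nat n" and adj: "successively adj ps"
    and cover: "\<And>u v. u \<in> {0..<r} \<Longrightarrow> v \<in> {0..<c} \<Longrightarrow> \<exists>u'. (u', v) \<in> set ps \<and> r dvd u' - u"
    and close: "{vertex (last ps), vertex (hd ps)} \<in> stripe_edges n a1 \<and> int (hsteps ps) \<le> K \<or>
      {vertex (last ps), vertex (hd ps)} \<in> stripe_edges n a2 \<and> int (hsteps ps) + 1 \<le> K"
  shows "\<exists>t. tour n a1 a2 t \<and> tour_cost n a2 t \<le> K"
proof (intro exI conjI)
  let ?t = "map vertex ps"
  let ?e = "{vertex (last ps), vertex (hd ps)}"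
  have ne: "ps \<noteq> []" using len n_ge4 by auto
  have "{0..<n} \<subseteq> set ?t"
  proof
    fix w assume w: "w \<in> {0..<n}"
    obtain u' where u': "(u', col w) \<in> set ps" "r dvd u' - row w" using cover[OF coord(1,2)] by blast
    have "n dvd (u' - row w) * a1" using u' n_dvd_mult_a1_iff by simp
    from dvd_diff[OF coord(3)[of w] this] have "n dvd w - (u' * a1 + col w * a2)"
      by (simp add: algebra_simps)
    then have "w mod n = vertex (u', col w)" unfolding vertex_def by (simp add: mod_eq_dvd_iff)
    then show "w \<in> set ?t" using w u' by (metis (no_types, lifting) atLeastLessThan_iff image_eqI list.set_map mod_pos_pos_trivial)
  qed
  then have set_t: "set ?t = {0..<n}" using vertex_in by auto
  have "card (set ?t) = length ?t" unfolding set_t using len by simp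
  then have dist: "distinct ?t" by (rule card_distinct)
  have sub: "cycle_edges ?t \<subseteq> insert ?e (path_edges ?t)"
    using cycle_edges_subset[of ?t] ne by (simp add: last_map hd_map)
  note pe = path_edges_vertex[OF adj]
  show "tour n a1 a2 ?t"
    unfolding tour_def hamiltonian_cycle_def
    using set_t dist sub pe close len n_ge4 by auto
  have "card (cycle_edges ?t \<inter> stripe_edges n a2) \<le> card (insert ?e (path_edges ?t) \<inter> stripe_edges n a2)"
    using sub by (intro card_mono) auto
  moreover have "int (card (insert ?e (path_edges ?t) \<inter> stripe_edges n a2)) \<le> K"
    using close
  proof
    assume a: "?e \<in> stripe_edges n a1 \<and> int (hsteps ps) \<le> K"
    then have "insert ?e (path_edges ?t) \<inter> stripe_edges n a2 = path_edges ?t \<inter> stripe_edges n a2"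
      using stripes_disjoint by blast
    then show ?thesis using conjunct2[OF pe] conjunct2[OF a] by simp
  next
    assume a: "?e \<in> stripe_edges n a2 \<and> int (hsteps ps) + 1 \<le> K"
    then have "insert ?e (path_edges ?t) \<inter> stripe_edges n a2 = insert ?e (path_edges ?t \<inter> stripe_edges n a2)"
      by blast
    moreover have "card (insert ?e (path_edges ?t \<inter> stripe_edges n a2)) \<le> Suc (card (path_edges ?t \<inter> stripe_edges n a2))"
      by (rule card_insert_le_m1) simp_all
    ultimately show ?thesis using conjunct2[OF pe] conjunct2[OF a] by simp
  qed
  ultimately show "tour_cost n a2 ?t \<le> K" unfolding tour_cost_def by simp
qed

text \<open>The step leaving the strip, already counted in \<open>H\<close>, leads to
  \<open>(d, c)\<close>, which by \<open>kernel\<close> is the starting vertex when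
  \<open>r dvd d - x\<close>.\<close>

lemma tour_from_strip:
  assumes s: "strip r (nat c) d H" and d: "r dvd d - x"
  shows "\<exists>t. tour n a1 a2 t \<and> tour_cost n a2 t \<le> int H"
proof -
  obtain ps where ps: "ps \<noteq> []" "hd ps = (0, 0)" "last ps = (0 + d, 0 + int (nat c) - 1)"
    "length ps = nat r * nat c" "successively adj ps" "hsteps ps + 1 = H"
    "\<forall>v\<in>{0..<0 + int (nat c)}. \<forall>u. \<exists>u'. (u', v) \<in> set ps \<and> r dvd u' - u"
    using s unfolding strip_def by meson
  have "n dvd d * a1 + c * a2" using d kernel by (metis mult_1)
  then have "n dvd - (d * a1 + c * a2)" by (simp only: dvd_minus_iff)
  then have "{vertex (last ps), vertex (hd ps)} \<in> stripe_edges n a2"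
    using ps(2,3) c2 by (intro vertex_edgeI) (simp add: algebra_simps)
  then show ?thesis
    using ps c2 r2 by (intro tour_from_path[of ps]) (auto simp: n_eq nat_mult_distrib)
qed

lemma tour_comb: "\<exists>t. tour n a1 a2 t \<and> tour_cost n a2 t \<le> 2 * c - 2"
proof -
  obtain ps where ps: "ps \<noteq> []" "hd ps = (1, 0)" "last ps \<in> {(1, c - 1), (r - 1, c - 1)}"
    "length ps = nat (r - 1) * nat c" "successively adj ps" "hsteps ps + 1 = nat c"
    "\<forall>v\<in>{0..<c}. \<forall>u\<in>{1..<r}. (u, v) \<in> set ps"
    using snake[OF r2, of "nat c"] c2 by auto
  \<comment> \<open>The unreduced name of row \<open>0\<close> that is adjacent to the end of the
    snake. Snake and return each make \<open>c - 1\<close> horizontal steps.\<close>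
  define \<rho> where "\<rho> = (if last ps = (1, c - 1) then 0 else r)"
  define qs where "qs = map (\<lambda>j. (\<rho>, c - 1 - int j)) [0..<nat c]"
  have qs: "qs \<noteq> []" "hd qs = (\<rho>, c - 1)" "last qs = (\<rho>, 0)" "length qs = nat c"
    using c2 unfolding qs_def by (auto simp: hd_map last_map of_nat_diff)
  have "successively adj qs"
    unfolding successively_conv_nth by (auto simp: qs_def adj_def)
  moreover have "adj (last ps) (hd qs)" using ps(3) qs(2) unfolding adj_def \<rho>_def by auto
  ultimately have adj: "successively adj (ps @ qs)"
    using ps(5) by (simp add: successively_append_iff)
  have "snd (last ps) = snd (hd qs)" using ps(3) qs(2) by auto
  then have h: "int (hsteps (ps @ qs)) \<le> 2 * c - 2"
    using hsteps_le[of qs] ps(1,6) qs c2 by (simp add: hsteps_append)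
  \<comment> \<open>The tour closes from \<open>(\<rho>, 0)\<close> to \<open>(1, 0)\<close> by a
    free edge, as \<open>r dvd \<rho>\<close>.\<close>
  have "n dvd (1 - \<rho>) * a1 + 0 * a2 - a1"
    using n_dvd_mult_a1_iff[of "- \<rho>"] unfolding \<rho>_def by (simp add: algebra_simps)
  then have close: "{vertex (last (ps @ qs)), vertex (hd (ps @ qs))} \<in> stripe_edges n a1"
    using ps(1,2) qs by (intro vertex_edgeI) simp
  have "length (ps @ qs) = nat n"
  proof -
    have "nat r = Suc (nat (r - 1))" using r2 by linarith
    then have "nat n = nat (r - 1) * nat c + nat c"
      using r2 n_eq by (simp add: nat_mult_distrib)
    then show ?thesis using ps(4) qs(4) by simp
  qed
  moreover have "\<exists>u'. (u', v) \<in> set (ps @ qs) \<and> r dvd u' - u" if "u \<in> {0..<r}" "v \<in> {0..<c}" for u v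
  proof (cases "u = 0")
    case True
    have "(\<rho>, v) \<in> set qs" unfolding qs_def using that by (auto intro!: image_eqI[of _ _ "nat (c - 1 - v)"])
    then show ?thesis using True by (intro exI[of _ \<rho>]) (auto simp: \<rho>_def)
  next
    case False
    then show ?thesis using ps(7) that by (intro exI[of _ u]) auto
  qed
  ultimately show ?thesis using tour_from_path[OF _ adj _] close h by blast
qed

section \<open>The optimal cost in terms of the smallest candidate\<close>

lemma mstar_candidate_iff:
  "mstar_candidate r c x m \<longleftrightarrow> 0 \<le> 2 * m + c \<and> (r dvd (2 * m + c) - x \<or> r dvd (2 * m + c) + x)"
proof -
  have "real_of_int m \<ge> - real_of_int c / 2 \<longleftrightarrow> real_of_int (2 * m + c) \<ge> 0"
    by (intro iffI; simp; linarith)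
  also have "\<dots> \<longleftrightarrow> 0 \<le> 2 * m + c" by (simp only: of_int_0_le_iff)
  finally have 1: "real_of_int m \<ge> - real_of_int c / 2 \<longleftrightarrow> 0 \<le> 2 * m + c" .
  have "x = z mod r \<longleftrightarrow> r dvd z - x" for z
    using x_range by (metis mod_eq_dvd_iff mod_pos_pos_trivial)
  moreover have "r dvd - (2 * m + c) - x \<longleftrightarrow> r dvd (2 * m + c) + x"
    by (subst dvd_minus_iff[symmetric]) (simp add: algebra_simps)
  ultimately show ?thesis unfolding mstar_candidate_def 1 by blast
qed

text \<open>Candidates \<open>m\<close> correspond to absolute row shifts \<open>2 * m + c\<close>;
  the two signs allowed for \<open>x\<close> absorb the sign of \<open>j\<close>.\<close>

lemma candidate_of_shift:
  assumes "r dvd j - x" "even (j - c)"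
  obtains m where "mstar_candidate r c x m" "2 * m + c = \<bar>j\<bar>"
proof
  let ?m = "(\<bar>j\<bar> - c) div 2"
  have "even (\<bar>j\<bar> - c)" using assms(2) by (auto simp: abs_if)
  then show *: "2 * ?m + c = \<bar>j\<bar>" by simp
  have "r dvd \<bar>j\<bar> - x \<or> r dvd \<bar>j\<bar> + x"
  proof (cases "j \<ge> 0")
    case False
    have "r dvd - (j - x)" using assms(1) by (simp only: dvd_minus_iff)
    then show ?thesis using False by (simp add: algebra_simps)
  qed (use assms(1) in simp)
  then show "mstar_candidate r c x ?m" unfolding mstar_candidate_iff * by simp
qed

lemma is_mstar_exists:
  assumes "mstar_candidate r c x m"
  obtains m' where "is_mstar r c x m'"
proof -
  \<comment> \<open>Candidates are at least \<open>- c\<close>, so shifting by \<open>c\<close>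
    reduces the minimum to one over the naturals.\<close>
  let ?P = "\<lambda>k. mstar_candidate r c x (int k - c)"
  have ge: "k \<ge> - c" if "mstar_candidate r c x k" for k using that c2 unfolding mstar_candidate_iff by linarith
  have "?P (nat (m + c))" using assms ge[OF assms] by simp
  then have L: "?P (LEAST k. ?P k)" by (rule LeastI)
  have "is_mstar r c x (int (LEAST k. ?P k) - c)"
    unfolding is_mstar_def
  proof (intro conjI allI impI L)
    fix k assume k: "mstar_candidate r c x k"
    then have "?P (nat (k + c))" using ge[OF k] by simp
    then have "(LEAST k. ?P k) \<le> nat (k + c)" by (rule Least_le)
    then show "int (LEAST k. ?P k) - c \<le> k" using ge[OF k] by linarith
  qed
  then show ?thesis by (rule that)
qed

text \<open>Below \<open>2 * c - 2\<close> the shift \<open>j\<close> of \<open>walk_bound\<close>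
  yields a candidate with \<open>c + 2 * m\<close> at most the cost, and the smallest candidate is
  no larger.\<close>

lemma tour_cost_lower:
  assumes t: "tour n a1 a2 t"
  shows "tour_cost n a2 t \<ge> 2 * c - 2 \<or>
    tour_cost n a2 t \<ge> c \<and> (\<exists>m. is_mstar r c x m \<and> tour_cost n a2 t \<ge> c + 2 * m)"
proof -
  obtain T where T: "walk T" "int (hcost T) \<le> tour_cost n a2 t" using tour_imp_walk[OF t] .
  show ?thesis
  proof (cases "int (hcost T) < 2 * c - 2")
    case True
    then obtain j where j: "r dvd j - x" "\<bar>j\<bar> \<le> int (hcost T)" "even (j - c)" "c \<le> int (hcost T)"
      using walk_bound[OF T(1)] by blast
    obtain m where m: "mstar_candidate r c x m" "2 * m + c = \<bar>j\<bar>" using candidate_of_shift[OF j(1,3)] .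
    obtain m' where m': "is_mstar r c x m'" using is_mstar_exists[OF m(1)] .
    then have "m' \<le> m" using m(1) unfolding is_mstar_def by blast
    then have "tour_cost n a2 t \<ge> c + 2 * m'" "tour_cost n a2 t \<ge> c" using m(2) j(2,4) T(2) by linarith+
    then show ?thesis using m' by blast
  next
    case False
    then show ?thesis using T(2) by linarith
  qed
qed

lemma is_mstar_unique: "is_mstar r c x m \<Longrightarrow> is_mstar r c x m' \<Longrightarrow> m = m'"
  unfolding is_mstar_def by (meson order_antisym)

lemma optimal_tour_costI:
  assumes "\<exists>t. tour n a1 a2 t \<and> tour_cost n a2 t \<le> K"
    and "\<And>t. tour n a1 a2 t \<Longrightarrow> K \<le> tour_cost n a2 t"
  shows "optimal_tour_cost n a1 a2 K"
  using assms unfolding optimal_tour_cost_def by (meson order_antisym)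

lemma optimal_nonpos:
  assumes m: "is_mstar r c x m" "m \<le> 0"
  shows "optimal_tour_cost n a1 a2 c"
proof (rule optimal_tour_costI)
  let ?s = "2 * m + c"
  have s: "0 \<le> ?s" "r dvd ?s - x \<or> r dvd ?s + x"
    using m(1) unfolding is_mstar_def mstar_candidate_iff by auto
  \<comment> \<open>The strip shifts rows by \<open>- S\<close> modulo \<open>r\<close>, and the
    tour closes for the shift \<open>x\<close>.\<close>
  define S where "S = (if r dvd ?s - x then - ?s else ?s)"
  have S: "r dvd S + x" using s(2) unfolding S_def by (auto simp: dvd_diff_commute algebra_simps)
  have "strip r (nat c) (S * (r - 1)) (nat c)"
    using s(1) m(2) r2 c2 by (intro strip_columns) (auto simp: S_def)
  moreover have "S * (r - 1) - x = S * r - (S + x)" by (simp add: algebra_simps)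
  moreover have "r dvd S * r - (S + x)" using S by (intro dvd_diff) auto
  ultimately have "\<exists>t. tour n a1 a2 t \<and> tour_cost n a2 t \<le> int (nat c)"
    by (metis tour_from_strip)
  then show "\<exists>t. tour n a1 a2 t \<and> tour_cost n a2 t \<le> c" using c2 by simp
  show "c \<le> tour_cost n a2 t" if "tour n a1 a2 t" for t
    using tour_cost_lower[OF that] c2 by auto
qed

lemma optimal_pos:
  assumes m: "is_mstar r c x m" "0 < 2 * m" "2 * m < c - 2"
  shows "optimal_tour_cost n a1 a2 (c + 2 * m)"
proof (rule optimal_tour_costI)
  let ?s = "2 * m + c"
  have s: "r dvd ?s - x \<or> r dvd ?s + x"
    using m(1) unfolding is_mstar_def mstar_candidate_iff by auto
  \<comment> \<open>Zigzags require \<open>r \<ge> 3\<close>. For \<open>r = 2\<close> only parity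
    matters, so \<open>- (c div 2)\<close> would be a smaller candidate.\<close>
  have "r \<noteq> 2"
  proof
    assume r: "r = 2"
    let ?m = "- (c div 2)"
    have "r dvd (2 * ?m + c) - x"
      using s unfolding r by presburger
    moreover have "0 \<le> 2 * ?m + c" by presburger
    ultimately have "mstar_candidate r c x ?m" unfolding mstar_candidate_iff by blast
    then have "m \<le> ?m" using m(1) unfolding is_mstar_def by blast
    then show False using m(2) c2 by linarith
  qed
  then have r3: "r \<ge> 3" using r2 by simp
  define \<sigma> :: int where "\<sigma> = (if r dvd ?s - x then -1 else 1)"
  have \<sigma>: "\<sigma> = 1 \<or> \<sigma> = -1" "r dvd \<sigma> * ?s + x"
    using s unfolding \<sigma>_def by (auto simp: dvd_diff_commute algebra_simps)
  \<comment> \<open>\<open>e\<close> single columns and \<open>m\<close> zigzags use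
    \<open>e + 2 * m = c\<close> columns at cost \<open>e + 4 * m = c + 2 * m\<close>.\<close>
  define e where "e = nat (c - 2 * m)"
  have e: "e > 0" "e + 2 * nat m = nat c" "int e = c - 2 * m" "int (nat m) = m"
    using m(2,3) unfolding e_def by linarith+
  have "strip r (nat c) (\<sigma> * ((c - 2 * m) * (r - 1) + m * (2 * r - 4))) (e + 4 * nat m)"
    using strip_zigzags[OF r3 \<sigma>(1) e(1), of "nat m"] unfolding e .
  moreover have "\<sigma> * ((c - 2 * m) * (r - 1) + m * (2 * r - 4)) - x = \<sigma> * c * r - (\<sigma> * ?s + x)"
    by (simp add: algebra_simps)
  moreover have "r dvd \<sigma> * c * r - (\<sigma> * ?s + x)" using \<sigma>(2) by (intro dvd_diff) auto
  ultimately have "\<exists>t. tour n a1 a2 t \<and> tour_cost n a2 t \<le> int (e + 4 * nat m)"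
    by (metis tour_from_strip)
  moreover have "int (e + 4 * nat m) = c + 2 * m" using e(3,4) by linarith
  ultimately show "\<exists>t. tour n a1 a2 t \<and> tour_cost n a2 t \<le> c + 2 * m" by metis
  show "c + 2 * m \<le> tour_cost n a2 t" if "tour n a1 a2 t" for t
    using tour_cost_lower[OF that] is_mstar_unique[OF m(1)] m(3) by auto
qed

lemma optimal_comb:
  assumes "(\<exists>m. is_mstar r c x m \<and> 2 * m \<ge> c - 2) \<or> (\<nexists>m. is_mstar r c x m)"
  shows "optimal_tour_cost n a1 a2 (2 * c - 2)"
proof (rule optimal_tour_costI[OF tour_comb])
  show "2 * c - 2 \<le> tour_cost n a2 t" if "tour n a1 a2 t" for t
    using tour_cost_lower[OF that] is_mstar_unique assms by force
qed

end

theorem theorem1: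
  fixes n a1 a2 g1 r c x :: int
  assumes "two_stripe_instance n a1 a2"
    and "g1 = gcd n a1"
    and "r = n div g1"
    and "c = g1"
    and "cylindrical_coords n a1 a2 ((- a2) mod n) (x, c - 1)"
  shows "(\<forall>m. is_mstar r c x m \<and> m \<le> 0 \<longrightarrow> optimal_tour_cost n a1 a2 c) \<and>
    (\<forall>m. is_mstar r c x m \<and> 0 < 2 * m \<and> 2 * m < c - 2 \<longrightarrow>
          optimal_tour_cost n a1 a2 (c + 2 * m)) \<and>
    ((\<exists>m. is_mstar r c x m \<and> 2 * m \<ge> c - 2) \<or> (\<nexists>m. is_mstar r c x m) \<longrightarrow>
          optimal_tour_cost n a1 a2 (2 * c - 2))"
proof -
  have inst: "1 \<le> a1" "a1 \<le> n div 2" "c > 1" "gcd c a2 = 1"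
    using assms(1,2,4) unfolding two_stripe_instance_def by auto
  have c: "gcd n a1 = c" using assms(2,4) by simp
  have n: "n = r * c" using assms(3,4) c by (metis dvd_div_mult_self gcd_dvd1)
  \<comment> \<open>The bound \<open>a1 \<le> n div 2\<close> enters only here, giving at least two
    rows.\<close>
  have "c \<le> a1" using c inst(1) by (metis gcd_dvd2 zdvd_imp_le less_le_trans zero_less_one)
  then have "2 * c \<le> r * c" using inst(2) n by linarith
  then have r2: "r \<ge> 2" using inst(3) by simp
  have x: "0 \<le> x" "x < r" and cong: "[(- a2) mod n = x * a1 + (c - 1) * a2] (mod n)"
    using assms(3,4,5) c unfolding cylindrical_coords_def by auto
  have "n dvd (x * a1 + (c - 1) * a2) - (- a2)"
    using cong by (metis cong_def cong_iff_dvd_diff cong_mod_left cong_sym)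
  then have "n dvd c * a2 + x * a1" by (simp add: algebra_simps)
  then interpret stripes n a1 a2 r c x
    using r2 inst n c x by unfold_locales auto
  show ?thesis using optimal_nonpos optimal_pos optimal_comb by blast
qed

end
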